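(* Let $n\ge 3$, let $\mathcal{G}\subseteq\mathrm{GL}_{n-1}(\mathbb{Z})$ be the integer representation of the Weyl group of type $\mathrm{A}_{n-1}$ with respect to the fundamental weights, and let $\mathcal{T}$ be its $\mathbb{T}$-orbit space. Let $\mathcal{Z}=\{z\in\mathbb{C}^{n-1}\mid \overline{z_i}=z_{n-i}\text{ for all }1\le i\le n-1\}$, an $(n-1)$-dimensional real vector space. With the convention $z_0=z_n=1$, set for $1\le\ell\le n$ \[ d_\ell(z)=(-1)^\ell\sum_{i=0}^{\ell}\binom{n}{i}\binom{n}{\ell-i}\,z_i\,z_{n-\ell+i}\in\mathbb{Q}[z_1,\dots,z_{n-1}], \] and let $C\in\mathbb{Q}[z]^{n\times n}$ be the matrix \[ C(z)=\begin{bmatrix} 0&1/2&&&0&-d_n(z)/4\\ 1&0&\ddots&&&-d_{n-1}(z)/2\\ &1/2&\ddots&\ddots&&\vdots\\ &&\ddots&\ddots&1/2&-d_3(z)/2\\ &&&\ddots&0&(1-d_2(z))/2\\ 0&&&&1/2&-d_1(z)/2 \end{bmatrix}. \] Define $H\in\mathbb{Q}[z]^{n\times n}$ by $H(z)_{ij}=\mathrm{Tr}\big(C(z)^{i+j-2}-C(z)^{i+j}\big)$. Then $H(z)\in\mathbb{R}^{n\times n}$ for all $z\in\mathcal{Z}$, and \[ \mathcal{T}=\{z\in\mathcal{Z}\mid H(z)\succeq0\}. \]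
   Context: $\mathbb{T}=\{x\in\mathbb{C}\mid|x|=1\}$; $\succeq0$ means positive semidefinite. Explicitly, the entries of $C(z)$ are: $C_{21}=1$; $C_{j+1,j}=1/2$ for $2\le j\le n-1$; $C_{j,j+1}=1/2$ for $1\le j\le n-2$; last column $C_{1,n}=-d_n/4$, $C_{j,n}=-d_{n+1-j}/2$ for $2\le j\le n$, $j\neq n-1$ and $C_{n-1,n}=(1-d_2)/2$ (and the entry $C_{n,n}=-d_1/2$); all remaining entries are $0$. (For $j=n-1$, the value $(1-d_2)/2$ overrides.) Here, for the subdiagonal, only the columns $1,\dots,n-1$ are concerned. The Weyl group $\mathcal{W}\cong\mathfrak{S}_n$ of $\mathrm{A}_{n-1}$ acts on $\{u\in\mathbb{R}^n\mid\sum u_i=0\}$ by permutation of coordinates; the fundamental weights are $\omega_i=\sum_{j\le i}\epsilon_j-\frac in\sum_{j=1}^n\epsilon_j$, $1\le i\le n-1$ ($\epsilon_j$ standard basis vectors of $\mathbb{R}^n$). The integer representation $\mathcal{G}$ is the group of matrices of elements of $\mathcal{W}$ in the basis $\omega_1,\dots,\omega_{n-1}$. For $x\in(\mathbb{C}^* )^{n-1}$ and $\alpha\in\mathbb{Z}^{n-1}$, $x^\alpha=\prod x_i^{\alpha_i}$. The fundamental invariants are $\theta_i(x)=\frac1{|\mathcal{G}|}\sum_{B\in\mathcal{G}}x^{Be_i}$, $1\le i\le n-1$ ($e_i$ standard basis of $\mathbb{Z}^{n-1}$). The $\mathbb{T}$-orbit space is $\mathcal{T}=\{(\theta_1(x),\dots,\theta_{n-1}(x))\mid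 x\in\mathbb{T}^{n-1}\}\subseteq\mathbb{C}^{n-1}$. *)

theory Defs
  imports
    Complex_Main
    "HOL-Combinatorics.Permutations"
    "Jordan_Normal_Form.Matrix"
begin

text \<open>
  The library indexes vectors and matrices from 0, the mathematics below from 1: the
  \<open>i\<close>-th coordinate of \<open>v\<close> is \<open>v $ (i - 1)\<close>.
  Polynomials and polynomial matrices in \<open>z\<close> are represented by their evaluations at
  points \<open>z\<close> of \<open>carrier_vec (n - 1)\<close>.
\<close>

subsection \<open>The Weyl group of type A and its integer representation\<close>

text \<open>
  \<open>weyl_act n \<pi>\<close> sends the standard basis vector with index \<open>j\<close> to the one with index \<open>\<pi> j\<close>.
\<close>

definition weyl_act :: "nat \<Rightarrow> (nat \<Rightarrow> nat) \<Rightarrow> real vec \<Rightarrow> real vec" where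
  "weyl_act n \<pi> u = vec n (\<lambda>k. u $ (inv_into UNIV \<pi> k))"

text \<open>
  The fundamental weight \<open>\<omega>\<^sub>i\<close>, i.e. the sum of the first \<open>i\<close> standard basis vectors minus
  \<open>i / n\<close> times the sum of all of them.
\<close>

definition fundamental_weight :: "nat \<Rightarrow> nat \<Rightarrow> real vec" where
  "fundamental_weight n i = vec n (\<lambda>k. (if k < i then 1 else 0) - real i / real n)"

text \<open>
  Columns of \<open>B\<close> hold the coordinates of the images of the fundamental weights:
  \<open>\<pi> \<cdot> \<omega>\<^sub>j = (\<Sum>i. B\<^sub>i\<^sub>j \<omega>\<^sub>i)\<close>.
\<close>

definition weyl_integer_rep :: "nat \<Rightarrow> int mat set" where
  "weyl_integer_rep n =
    {B \<in> carrier_mat (n - 1) (n - 1).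
      \<exists>\<pi>. \<pi> permutes {..<n} \<and>
        (\<forall>j<n - 1. weyl_act n \<pi> (fundamental_weight n (j + 1)) =
          vec n (\<lambda>k. \<Sum>i<n - 1. of_int (B $$ (i, j)) * fundamental_weight n (i + 1) $ k))}"


subsection \<open>Fundamental invariants and the orbit space\<close>

definition laurent_monom :: "complex vec \<Rightarrow> int vec \<Rightarrow> complex" where
  "laurent_monom x \<alpha> = (\<Prod>i<dim_vec x. (x $ i) powi (\<alpha> $ i))"

definition fundamental_invariant :: "nat \<Rightarrow> nat \<Rightarrow> complex vec \<Rightarrow> complex" where
  "fundamental_invariant n i x =
    (1 / of_nat (card (weyl_integer_rep n))) *
    (\<Sum>B\<in>weyl_integer_rep n. laurent_monom x (B *\<^sub>v unit_vec (n - 1) (i - 1)))"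

definition compact_torus :: "nat \<Rightarrow> complex vec set" where
  "compact_torus m = {x \<in> carrier_vec m. \<forall>i<m. cmod (x $ i) = 1}"

definition orbit_space :: "nat \<Rightarrow> complex vec set" where
  "orbit_space n =
    (\<lambda>x. vec (n - 1) (\<lambda>k. fundamental_invariant n (k + 1) x)) ` compact_torus (n - 1)"


subsection \<open>The Hermite matrix polynomial\<close>

text \<open>The coordinate \<open>z\<^sub>i\<close> for \<open>0 \<le> i \<le> n\<close>, with the convention \<open>z\<^sub>0 = z\<^sub>n = 1\<close>.\<close>

definition zcoord :: "nat \<Rightarrow> complex vec \<Rightarrow> nat \<Rightarrow> complex" where
  "zcoord n z i = (if i = 0 \<or> i = n then 1 else z $ (i - 1))"

definition conj_space :: "nat \<Rightarrow> complex vec set" where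
  "conj_space n =
    {z \<in> carrier_vec (n - 1). \<forall>i\<in>{1..n - 1}. cnj (zcoord n z i) = zcoord n z (n - i)}"

definition dpoly :: "nat \<Rightarrow> nat \<Rightarrow> complex vec \<Rightarrow> complex" where
  "dpoly n l z =
    (- 1) ^ l * (\<Sum>i = 0..l. of_nat (n choose i) * of_nat (n choose (l - i)) *
      zcoord n z i * zcoord n z (n - l + i))"

text \<open>The entry of \<open>C(z)\<close> in row \<open>j\<close> and column \<open>k\<close>, where \<open>1 \<le> j, k \<le> n\<close> and \<open>n \<ge> 3\<close>.\<close>

definition C_entry :: "nat \<Rightarrow> complex vec \<Rightarrow> nat \<Rightarrow> nat \<Rightarrow> complex" where
  "C_entry n z j k =
    (if k = n then
       (if j = 1 then - dpoly n n z / 4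
        else if j = n - 1 then (1 - dpoly n 2 z) / 2
        else - dpoly n (n + 1 - j) z / 2)
     else if j = k + 1 then (if k = 1 then 1 else 1 / 2)
     else if k = j + 1 then 1 / 2
     else 0)"

definition C_mat :: "nat \<Rightarrow> complex vec \<Rightarrow> complex mat" where
  "C_mat n z = mat n n (\<lambda>(i, j). C_entry n z (i + 1) (j + 1))"

definition mat_trace :: "'a :: comm_monoid_add mat \<Rightarrow> 'a" where
  "mat_trace A = (\<Sum>i<dim_row A. A $$ (i, i))"

text \<open>The exponents \<open>i + j - 2\<close> and \<open>i + j\<close> become \<open>i + j\<close> and \<open>i + j + 2\<close> with indices from 0.\<close>

definition H_mat :: "nat \<Rightarrow> complex vec \<Rightarrow> complex mat" where
  "H_mat n z =
    mat n n (\<lambda>(i, j). mat_trace (C_mat n z ^\<^sub>m (i + j) - C_mat n z ^\<^sub>m (i + j + 2)))"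

definition psd_mat :: "real mat \<Rightarrow> bool" where
  "psd_mat M \<longleftrightarrow> square_mat M \<and> transpose_mat M = M \<and>
    (\<forall>v \<in> carrier_vec (dim_row M). 0 \<le> v \<bullet> (M *\<^sub>v v))"

end

theory Submission
  imports Defs "Jordan_Normal_Form.Schur_Decomposition"
begin

text \<open>
  Writing the torus coordinates as \<open>x\<^sub>i = y\<^sub>1 \<cdots> y\<^sub>i\<close> with \<open>y\<^sub>1 \<cdots> y\<^sub>n = 1\<close>, the Weyl group permutes the
  \<open>y\<^sub>k\<close>, so the invariant \<open>\<theta>\<^sub>i\<close> is the elementary symmetric polynomial \<open>e\<^sub>i(y)\<close> divided by the number
  of its terms. Hence every \<open>z\<close> comes from the roots \<open>y\<^sub>k\<close> of a polynomial, and \<open>z\<close> lies in the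
  orbit space iff all \<open>y\<^sub>k\<close> lie on the unit circle, i.e. iff all \<open>c\<^sub>k = (y\<^sub>k + 1 / y\<^sub>k) / 2\<close> are real
  and in \<open>[-1, 1]\<close>. The matrix \<open>C(z)\<close> represents multiplication by the variable in the Chebyshev
  basis modulo \<open>\<Prod>(X - c\<^sub>k)\<close>, because the \<open>d\<^sub>l\<close> are, up to sign, the coefficients of
  \<open>\<Prod>(t - y\<^sub>k)(t - 1 / y\<^sub>k)\<close>. So \<open>H(z)\<close> is the matrix of the Hermite form
  \<open>f \<mapsto> \<Sum>(1 - c\<^sub>k\<^sup>2) f(c\<^sub>k)\<^sup>2\<close> on real polynomials of degree below \<open>n\<close>, and Hermite's argument
  applies.
\<close>

subsection \<open>Traces of powers\<close>

lemma mat_trace_minus: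
  assumes "(A :: 'a :: ab_group_add mat) \<in> carrier_mat n n" "B \<in> carrier_mat n n"
  shows "mat_trace (A - B) = mat_trace A - mat_trace B"
  using assms by (simp add: mat_trace_def sum_subtractf)

lemma mat_trace_of_real:
  "A \<in> carrier_mat n n \<Longrightarrow> mat_trace (map_mat of_real A) = of_real (mat_trace A)"
  by (simp add: mat_trace_def)

lemma mat_trace_mult_commute:
  assumes A: "(A :: 'a :: comm_semiring_0 mat) \<in> carrier_mat n m" and B: "B \<in> carrier_mat m n"
  shows "mat_trace (A * B) = mat_trace (B * A)"
proof -
  have "mat_trace (A * B) = (\<Sum>i<n. \<Sum>k<m. A $$ (i,k) * B $$ (k,i))"
    using A B by (auto simp: mat_trace_def scalar_prod_def lessThan_atLeast0 intro!: sum.cong)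
  also have "\<dots> = (\<Sum>k<m. \<Sum>i<n. B $$ (k,i) * A $$ (i,k))"
    by (subst sum.swap) (simp add: mult.commute)
  also have "\<dots> = mat_trace (B * A)"
    using A B by (auto simp: mat_trace_def scalar_prod_def lessThan_atLeast0 intro!: sum.cong)
  finally show ?thesis .
qed

lemma upper_triangular_mult:
  assumes A: "(A :: 'a :: semiring_0 mat) \<in> carrier_mat n n" "upper_triangular A"
    and B: "B \<in> carrier_mat n n" "upper_triangular B"
  shows "upper_triangular (A * B)"
    and "\<And>i. i < n \<Longrightarrow> (A * B) $$ (i,i) = A $$ (i,i) * B $$ (i,i)"
proof -
  have entry: "(A * B) $$ (i,j) = (\<Sum>k<n. A $$ (i,k) * B $$ (k,j))" if "i < n" "j < n" for i j
    using A B that by (auto simp: scalar_prod_def lessThan_atLeast0 intro!: sum.cong)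
  have zA: "A $$ (i,j) = 0" if "j < i" "i < n" for i j
    using A that by (auto intro: upper_triangularD)
  have zB: "B $$ (i,j) = 0" if "j < i" "i < n" for i j
    using B that by (auto intro: upper_triangularD)
  show "upper_triangular (A * B)"
  proof (rule upper_triangularI)
    fix i j assume ij: "j < i" "i < dim_row (A * B)"
    have "A $$ (i,k) * B $$ (k,j) = 0" if "k < n" for k
      using zA[of k i] zB[of j k] ij that A by (cases "k < i") auto
    then show "(A * B) $$ (i,j) = 0"
      using entry[of i j] ij A by simp
  qed
  fix i assume i: "i < n"
  have "(\<Sum>k<n. A $$ (i,k) * B $$ (k,i)) = (\<Sum>k<n. if k = i then A $$ (i,i) * B $$ (i,i) else 0)"
  proof (rule sum.cong[OF refl])
    fix k assume "k \<in> {..<n}"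
    then show "A $$ (i,k) * B $$ (k,i) = (if k = i then A $$ (i,i) * B $$ (i,i) else 0)"
      using zA[of k i] zB[of i k] i by (cases k i rule: linorder_cases) auto
  qed
  then show "(A * B) $$ (i,i) = A $$ (i,i) * B $$ (i,i)"
    using entry[OF i i] i by simp
qed

lemma upper_triangular_pow:
  assumes A: "(A :: 'a :: semiring_1 mat) \<in> carrier_mat n n" "upper_triangular A"
  shows "upper_triangular (A ^\<^sub>m k) \<and> (\<forall>i<n. (A ^\<^sub>m k) $$ (i,i) = A $$ (i,i) ^ k)"
proof (induction k)
  case 0
  then show ?case using A by auto
next
  case (Suc k)
  have c: "A ^\<^sub>m k \<in> carrier_mat n n" using A by simp
  show ?case
    using upper_triangular_mult[OF c _ A] Suc by (simp add: power_commutes)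
qed

lemma mat_trace_pow_eq_power_sum:
  assumes A: "(A :: complex mat) \<in> carrier_mat n n"
    and cp: "char_poly A = (\<Prod>k<n. [:- c k, 1:])"
  shows "mat_trace (A ^\<^sub>m m) = (\<Sum>k<n. c k ^ m)"
proof -
  define es where "es = map c [0..<n]"
  have "char_poly A = (\<Prod>e\<leftarrow>es. [:- e, 1:])"
    unfolding cp es_def by (simp add: prod.list_conv_set_nth lessThan_atLeast0)
  moreover obtain B P Q where "schur_decomposition A es = (B, P, Q)"
    by (cases "schur_decomposition A es")
  ultimately have wit: "similar_mat_wit A B P Q" and ut: "upper_triangular B"
    and diag: "diag_mat B = es"
    using schur_decomposition[OF A] by auto
  note w = similar_mat_witD2[OF A wit]
  have B: "B \<in> carrier_mat n n" "P \<in> carrier_mat n n" "Q \<in> carrier_mat n n" using w by auto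
  have Bk: "B ^\<^sub>m m \<in> carrier_mat n n" using B by simp
  have bc: "B $$ (i,i) = c i" if "i < n" for i
  proof -
    have "diag_mat B ! i = B $$ (i,i)" using B that by (simp add: diag_mat_def)
    then show ?thesis using diag that by (simp add: es_def)
  qed
  have "mat_trace (A ^\<^sub>m m) = mat_trace (P * (B ^\<^sub>m m * Q))"
    using similar_mat_wit_pow_id[OF wit, of m] B Bk by (simp add: assoc_mult_mat[of _ n n _ n _ n])
  also have "\<dots> = mat_trace ((B ^\<^sub>m m * Q) * P)"
    using B Bk by (intro mat_trace_mult_commute) auto
  also have "(B ^\<^sub>m m * Q) * P = B ^\<^sub>m m * (Q * P)"
    using B Bk by (simp add: assoc_mult_mat[of _ n n _ n _ n])
  also have "\<dots> = B ^\<^sub>m m" using w Bk by simp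
  also have "mat_trace (B ^\<^sub>m m) = (\<Sum>k<n. c k ^ m)"
    using upper_triangular_pow[OF B(1) ut, of m] bc B Bk by (auto simp: mat_trace_def)
  finally show ?thesis .
qed

subsection \<open>The comrade matrix of the Chebyshev basis\<close>

fun chebyshev :: "nat \<Rightarrow> complex poly" where
  "chebyshev 0 = 1"
| "chebyshev (Suc 0) = [:0, 1:]"
| "chebyshev (Suc (Suc n)) = [:0, 2:] * chebyshev (Suc n) - chebyshev n"

lemma poly_chebyshev_joukowski:
  assumes "t * s = 1"
  shows "poly (chebyshev k) ((t + s) / 2) = (t ^ k + s ^ k) / 2"
proof (induction k rule: chebyshev.induct)
  case (3 n)
  have "(t + s) * (t ^ Suc n + s ^ Suc n) = t ^ Suc (Suc n) + s ^ Suc (Suc n) + (t * s) * (t ^ n + s ^ n)"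
    by (simp add: algebra_simps)
  then have "(t + s) * (t ^ Suc n + s ^ Suc n) = t ^ Suc (Suc n) + s ^ Suc (Suc n) + (t ^ n + s ^ n)"
    by (simp add: assms)
  note rec = this
  have "poly (chebyshev (Suc (Suc n))) ((t + s) / 2) =
      (t + s) * poly (chebyshev (Suc n)) ((t + s) / 2) - poly (chebyshev n) ((t + s) / 2)"
    by simp
  also have "\<dots> = (t + s) * ((t ^ Suc n + s ^ Suc n) / 2) - (t ^ n + s ^ n) / 2"
    by (simp only: 3)
  also have "\<dots> = ((t + s) * (t ^ Suc n + s ^ Suc n) - (t ^ n + s ^ n)) / 2"
    by (simp only: times_divide_eq_right diff_divide_distrib)
  finally show ?case unfolding rec by simp
qed simp_all

definition comrade_poly :: "nat \<Rightarrow> complex vec \<Rightarrow> complex poly" where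
  "comrade_poly n z = [:dpoly n n z / 4:] +
    (\<Sum>i = 1..<n. smult (dpoly n (n - i) z / 2) (chebyshev i)) + smult (1 / 2) (chebyshev n)"

lemma chebyshev_C_column:
  assumes n: "n \<ge> 3" and j: "j < n"
  shows "(\<Sum>i<n. chebyshev i * char_poly_matrix (C_mat n z) $$ (i, j)) =
    (if j = n - 1 then comrade_poly n z else 0)"
proof -
  let ?C = "\<lambda>i. C_entry n z (i + 1) (j + 1)"
  have ent: "char_poly_matrix (C_mat n z) $$ (i, j) = (if i = j then [:0, 1:] else 0) - [:?C i:]"
    if "i < n" for i
    using that j by (simp add: char_poly_matrix_def C_mat_def)
  have "(\<Sum>i<n. chebyshev i * char_poly_matrix (C_mat n z) $$ (i, j)) =
      (\<Sum>i<n. (if i = j then [:0, 1:] * chebyshev i else 0) - smult (?C i) (chebyshev i))"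
    by (intro sum.cong refl) (auto simp: ent algebra_simps)
  also have "\<dots> = [:0, 1:] * chebyshev j - (\<Sum>i<n. smult (?C i) (chebyshev i))"
    using j by (simp add: sum_subtractf)
  finally have *: "(\<Sum>i<n. chebyshev i * char_poly_matrix (C_mat n z) $$ (i, j)) =
      [:0, 1:] * chebyshev j - (\<Sum>i<n. smult (?C i) (chebyshev i))" .
  show ?thesis
  proof (cases "j = n - 1")
    case False
    have eq: "smult (?C i) (chebyshev i) =
        (if i = j + 1 then smult (if j = 0 then 1 else 1 / 2) (chebyshev i) else 0) +
        (if i = j - 1 then (if j = 0 then 0 else smult (1 / 2) (chebyshev i)) else 0)"
      if "i < n" for i
      using that False j by (auto simp: C_entry_def)
    have "(\<Sum>i<n. smult (?C i) (chebyshev i)) =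
        smult (if j = 0 then 1 else 1 / 2) (chebyshev (j + 1)) +
        (if j = 0 then 0 else smult (1 / 2) (chebyshev (j - 1)))"
    proof -
      have "j + 1 < n" "j - 1 < n" using False j by auto
      then show ?thesis using eq by (simp add: sum.distrib)
    qed
    also have "\<dots> = [:0, 1:] * chebyshev j"
    proof (cases j)
      case (Suc m)
      then show ?thesis by (simp add: smult_diff_right)
    qed simp
    finally show ?thesis using * False by simp
  next
    case True
    let ?D = "\<lambda>i. if i = 0 then - dpoly n n z / 4 else - dpoly n (n - i) z / 2"
    have "smult (?C i) (chebyshev i) = smult (?D i) (chebyshev i) +
        (if i = n - 2 then smult (1 / 2) (chebyshev i) else 0)"
      if "i < n" for i
      using that True n by (auto simp: C_entry_def diff_divide_distrib smult_diff_left)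
    then have "(\<Sum>i<n. smult (?C i) (chebyshev i)) =
        (\<Sum>i<n. smult (?D i) (chebyshev i)) + smult (1 / 2) (chebyshev (n - 2))"
      using n by (simp add: sum.distrib)
    also have "(\<Sum>i<n. smult (?D i) (chebyshev i)) =
        [:- dpoly n n z / 4:] - (\<Sum>i = 1..<n. smult (dpoly n (n - i) z / 2) (chebyshev i))"
    proof -
      have "(\<Sum>i<n. smult (?D i) (chebyshev i)) =
        smult (?D 0) (chebyshev 0) + (\<Sum>i = 1..<n. smult (?D i) (chebyshev i))"
        using n by (simp add: lessThan_atLeast0 sum.atLeast_Suc_lessThan)
      also have "(\<Sum>i = 1..<n. smult (?D i) (chebyshev i)) =
          - (\<Sum>i = 1..<n. smult (dpoly n (n - i) z / 2) (chebyshev i))"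
        unfolding sum_negf[symmetric] by (intro sum.cong) auto
      finally show ?thesis by (simp add: one_pCons)
    qed
    finally have s: "(\<Sum>i<n. smult (?C i) (chebyshev i)) = [:- dpoly n n z / 4:] -
      (\<Sum>i = 1..<n. smult (dpoly n (n - i) z / 2) (chebyshev i)) +
      smult (1 / 2) (chebyshev (n - 2))" .
    obtain m where m: "n = Suc (Suc m)" using n by (metis add_2_eq_Suc le_Suc_ex numeral_3_eq_3 Suc_leD numeral_2_eq_2)
    have "[:0, 1:] * chebyshev j = smult (1 / 2) (chebyshev n) + smult (1 / 2) (chebyshev (n - 2))"
      using True by (simp add: m smult_diff_right)
    moreover have "[:- dpoly n n z / 4:] = - [:dpoly n n z / 4:]" by simp
    ultimately show ?thesis unfolding * s comrade_poly_def using True by (simp add: algebra_simps)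
  qed
qed

lemma char_poly_C_mat_comrade:
  assumes n: "n \<ge> 3"
  shows "smult 4 (comrade_poly n z) = smult (2 ^ n) (char_poly (C_mat n z))"
proof -
  define A where "A = char_poly_matrix (C_mat n z)"
  have C: "C_mat n z \<in> carrier_mat n n" by (simp add: C_mat_def)
  then have A: "A \<in> carrier_mat n n" by (simp add: A_def)
  note adj = adj_mat[OF A]
  have mult: "(A * adj_mat A) $$ (i, 0) = (\<Sum>k<n. A $$ (i,k) * adj_mat A $$ (k,0))" if "i < n" for i
    using A adj(1) that by (auto simp: scalar_prod_def lessThan_atLeast0 intro!: sum.cong)
  have "char_poly (C_mat n z) = (\<Sum>i<n. chebyshev i * (det A \<cdot>\<^sub>m 1\<^sub>m n) $$ (i, 0))"
  proof -
    have "(\<Sum>i<n. chebyshev i * (det A \<cdot>\<^sub>m 1\<^sub>m n) $$ (i, 0)) =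
        (\<Sum>i<n. if i = 0 then det A else 0)"
      using n by (intro sum.cong) auto
    then show ?thesis using n by (simp add: char_poly_def A_def)
  qed
  also have "\<dots> = (\<Sum>i<n. \<Sum>k<n. chebyshev i * A $$ (i,k) * adj_mat A $$ (k,0))"
    using adj(2) mult by (simp add: sum_distrib_left mult.assoc)
  also have "\<dots> = (\<Sum>k<n. (\<Sum>i<n. chebyshev i * A $$ (i,k)) * adj_mat A $$ (k,0))"
    by (subst sum.swap) (simp add: sum_distrib_right)
  also have "\<dots> = (\<Sum>k<n. if k = n - 1 then comrade_poly n z * adj_mat A $$ (n - 1, 0) else 0)"
    using chebyshev_C_column[OF n, of _ z] by (intro sum.cong) (auto simp: A_def)
  also have "\<dots> = comrade_poly n z * adj_mat A $$ (n - 1, 0)"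
    using n by simp
  also have "adj_mat A $$ (n - 1, 0) = (- 1) ^ (n - 1) * det (mat_delete A 0 (n - 1))"
    using A n by (simp add: adj_mat_def cofactor_def)
  also have "det (mat_delete A 0 (n - 1)) = (\<Prod>i<n - 1. A $$ (Suc i, i))"
  proof -
    let ?M = "mat_delete A 0 (n - 1)"
    have M: "?M \<in> carrier_mat (n - 1) (n - 1)" using A by (rule mat_delete_carrier)
    have ent: "?M $$ (i,j) = A $$ (Suc i, j)" if "i < n - 1" "j < n - 1" for i j
      using that A by (simp add: mat_delete_def)
    have "upper_triangular ?M"
    proof (rule upper_triangularI)
      fix i j assume "j < i" "i < dim_row ?M"
      then show "?M $$ (i,j) = 0"
        using ent[of i j] A C
        by (simp add: A_def char_poly_matrix_def C_mat_def C_entry_def)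
    qed
    from det_upper_triangular[OF this M] show ?thesis
      using M A ent by (simp add: prod_list_diag_prod lessThan_atLeast0)
  qed
  also have "(\<Prod>i<n - 1. A $$ (Suc i, i)) = (\<Prod>i<n - 1. [:- (if i = 0 then 1 else 1 / 2):])"
    using C by (intro prod.cong) (auto simp: A_def char_poly_matrix_def C_mat_def C_entry_def)
  also have "\<dots> = [:(- 1) ^ (n - 1) / 2 ^ (n - 2):]"
  proof -
    obtain m where m: "n - 1 = Suc m" using n by (cases "n - 1") auto
    then have m': "n - 2 = m" by simp
    have "(\<Prod>i<Suc k. [:- (if i = 0 then 1 else 1 / 2):]) = [:(- 1) ^ (Suc k) / 2 ^ k :: complex:]" for k
      by (induction k) (auto simp: field_simps)
    then show ?thesis unfolding m m' .
  qed
  also have "(- 1) ^ (n - 1) * [:(- 1) ^ (n - 1) / 2 ^ (n - 2) :: complex:] = [:1 / 2 ^ (n - 2):]"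
    by (cases "even (n - 1)") auto
  finally have "char_poly (C_mat n z) = smult (1 / 2 ^ (n - 2)) (comrade_poly n z)" by simp
  moreover have "(2 :: complex) ^ n = 4 * 2 ^ (n - 2)"
  proof -
    have "2 + (n - 2) = n" using n by simp
    then have "(2 :: complex) ^ n = 2\<^sup>2 * 2 ^ (n - 2)" by (metis power_add)
    then show ?thesis by simp
  qed
  ultimately show ?thesis by simp
qed

subsection \<open>The orbit space in terms of elementary symmetric polynomials\<close>

definition esym :: "nat \<Rightarrow> nat \<Rightarrow> (nat \<Rightarrow> complex) \<Rightarrow> complex" where
  "esym n i y = (\<Sum>J | J \<subseteq> {..<n} \<and> card J = i. \<Prod>k\<in>J. y k)"

lemma permutes_image_of_card_eq:
  assumes J: "J \<subseteq> {..<n::nat}"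
  obtains \<sigma> where "\<sigma> permutes {..<n}" "\<sigma> ` {..<card J} = J"
proof -
  have fin: "finite J" using J finite_subset by blast
  have le: "card J \<le> n" using card_mono[OF _ J] by simp
  have "card {card J..<n} = card ({..<n} - J)"
    using J fin by (simp add: card_Diff_subset)
  then obtain g where g: "bij_betw g {card J..<n} ({..<n} - J)"
    by (metis finite_same_card_bij finite_Diff finite_lessThan finite_atLeastLessThan)
  obtain f where f: "bij_betw f {..<card J} J"
    using finite_same_card_bij[of "{..<card J}" J] fin by auto
  define \<sigma> where "\<sigma> i = (if i < card J then f i else if i < n then g i else i)" for i
  have 1: "bij_betw \<sigma> {..<card J} J"
    using f by (rule bij_betw_cong[THEN iffD1, rotated]) (simp add: \<sigma>_def)
  have 2: "bij_betw \<sigma> {card J..<n} ({..<n} - J)"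
    using g by (rule bij_betw_cong[THEN iffD1, rotated]) (simp add: \<sigma>_def)
  have "bij_betw \<sigma> ({..<card J} \<union> {card J..<n}) (J \<union> ({..<n} - J))"
    using 1 2 by (rule bij_betw_combine) auto
  moreover have "{..<card J} \<union> {card J..<n} = {..<n}" "J \<union> ({..<n} - J) = {..<n}"
    using le J by auto
  ultimately have "bij_betw \<sigma> {..<n} {..<n}" by simp
  then have "\<sigma> permutes {..<n}"
    by (rule bij_imp_permutes) (use le in \<open>auto simp: \<sigma>_def\<close>)
  with 1 show ?thesis using that by (simp add: bij_betw_def)
qed

text \<open>Double counting: the average over all permutations of the image of one \<open>j\<close>-set does not
  depend on the \<open>j\<close>-set.\<close>

lemma sum_permutations_prod_eq_esym:
  assumes j: "j \<le> n"
  shows "of_nat (n choose j) * (\<Sum>\<pi> | \<pi> permutes {..<n}. \<Prod>k\<in>\<pi> ` {..<j}. y k) =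
    fact n * esym n j y"
proof -
  let ?P = "{\<pi>. \<pi> permutes {..<n}}" and ?J = "{J. J \<subseteq> {..<n} \<and> card J = j}"
  have inv: "(\<Sum>\<pi>\<in>?P. \<Prod>k\<in>\<pi> ` {..<j}. y k) = (\<Sum>\<pi>\<in>?P. \<Prod>k\<in>\<pi> ` J. y k)" if "J \<in> ?J" for J
  proof -
    from that obtain \<sigma> where s: "\<sigma> permutes {..<n}" "\<sigma> ` {..<j} = J"
      using permutes_image_of_card_eq[of J n] by auto
    show ?thesis
      using sum_permutations_compose_right[OF s(1), of "\<lambda>\<pi>. \<Prod>k\<in>\<pi> ` {..<j}. y k"] s(2)
      by (simp only: image_comp[symmetric])
  qed
  have "card ?J = n choose j" using n_subsets[of "{..<n}" j] by simp
  then have "of_nat (n choose j) * (\<Sum>\<pi>\<in>?P. \<Prod>k\<in>\<pi> ` {..<j}. y k) =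
      (\<Sum>J\<in>?J. \<Sum>\<pi>\<in>?P. \<Prod>k\<in>\<pi> ` {..<j}. y k)" by simp
  also have "\<dots> = (\<Sum>J\<in>?J. \<Sum>\<pi>\<in>?P. \<Prod>k\<in>\<pi> ` J. y k)"
    by (rule sum.cong[OF refl]) (rule inv)
  also have "\<dots> = (\<Sum>\<pi>\<in>?P. \<Sum>J\<in>?J. \<Prod>k\<in>\<pi> ` J. y k)"
    by (rule sum.swap)
  also have "\<dots> = (\<Sum>\<pi>\<in>?P. esym n j y)"
  proof (rule sum.cong[OF refl])
    fix \<pi> assume "\<pi> \<in> ?P"
    then have p: "\<pi> permutes {..<n}" by simp
    have "bij_betw ((`) \<pi>) ?J ?J"
    proof (rule bij_betw_byWitness[where f' = "(`) (inv_into UNIV \<pi>)"])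
      show "\<forall>a\<in>?J. inv_into UNIV \<pi> ` \<pi> ` a = a" "\<forall>a\<in>?J. \<pi> ` inv_into UNIV \<pi> ` a = a"
        using permutes_inv_o[OF p] by (simp_all add: image_comp)
      have "q ` J \<in> ?J" if "q permutes {..<n}" "J \<in> ?J" for q J
        using that permutes_image[OF that(1)] card_image[OF inj_on_subset[OF permutes_inj[OF that(1)]]]
        by auto
      then show "(`) \<pi> ` ?J \<subseteq> ?J" "(`) (inv_into UNIV \<pi>) ` ?J \<subseteq> ?J"
        using p permutes_inv[OF p] by blast+
    qed
    then show "(\<Sum>J\<in>?J. \<Prod>k\<in>\<pi> ` J. y k) = esym n j y"
      unfolding esym_def by (rule sum.reindex_bij_betw)
  qed
  also have "\<dots> = fact n * esym n j y"
    using card_permutations[of "{..<n}" n] by simp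
  finally show ?thesis .
qed

definition weyl_mat :: "nat \<Rightarrow> (nat \<Rightarrow> nat) \<Rightarrow> int mat" where
  "weyl_mat n \<pi> = mat (n - 1) (n - 1)
    (\<lambda>(i, j). of_bool (inv_into UNIV \<pi> i < j + 1) - of_bool (inv_into UNIV \<pi> (i + 1) < j + 1))"

text \<open>Pairing with the coroot \<open>\<epsilon>\<^sub>k - \<epsilon>\<^sub>k\<^sub>+\<^sub>1\<close> extracts the \<open>k\<close>-th coordinate in the basis of
  fundamental weights.\<close>

lemma sum_fundamental_weight_coroot:
  assumes "k + 1 < n"
  shows "(\<Sum>i<n - 1. c i * fundamental_weight n (i + 1) $ k) -
    (\<Sum>i<n - 1. c i * fundamental_weight n (i + 1) $ (k + 1)) = c k"
proof -
  have "(\<Sum>i<n - 1. c i * fundamental_weight n (i + 1) $ k) -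
      (\<Sum>i<n - 1. c i * fundamental_weight n (i + 1) $ (k + 1)) = (\<Sum>i<n - 1. if i = k then c k else 0)"
    unfolding sum_subtractf[symmetric]
    using assms by (intro sum.cong) (auto simp: fundamental_weight_def algebra_simps)
  then show ?thesis using assms by simp
qed

lemma fundamental_weight_expansion:
  fixes u :: "nat \<Rightarrow> real"
  assumes k: "k < n" and sum0: "(\<Sum>i<n. u i) = 0"
  shows "(\<Sum>i<n - 1. (u i - u (i + 1)) * fundamental_weight n (i + 1) $ k) = u k"
proof -
  obtain m where m: "n = Suc m" using k by (cases n) auto
  have tel: "(\<Sum>i<m. (u i - u (i + 1)) * (if k < i + 1 then 1 else 0)) = u k - u m" if "k \<le> m" for m
    using that
  proof (induction m)
    case (Suc m)
    show ?case
    proof (cases "k \<le> m")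
      case False
      then have "k = Suc m" using Suc by simp
      then show ?thesis by (auto intro!: sum.neutral)
    qed (use Suc in simp)
  qed simp
  have tel2: "(\<Sum>i<m. (u i - u (i + 1)) * real (i + 1)) = (\<Sum>i<m. u i) - real m * u m" for m
    by (induction m) (simp_all add: algebra_simps)
  have "(\<Sum>i<n - 1. (u i - u (i + 1)) * fundamental_weight n (i + 1) $ k) =
    (\<Sum>i<m. (u i - u (i + 1)) * (if k < i + 1 then 1 else 0)) -
    (\<Sum>i<m. (u i - u (i + 1)) * real (i + 1)) / real n"
    unfolding sum_subtractf[symmetric] sum_divide_distrib
    using k by (intro sum.cong) (auto simp: fundamental_weight_def m algebra_simps diff_divide_distrib)
  also have "\<dots> = u k - u m - ((\<Sum>i<m. u i) - real m * u m) / real n"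
    using tel[of m] tel2[of m] k m by simp
  also have "(\<Sum>i<m. u i) = - u m" using sum0 by (simp add: m)
  finally show ?thesis by (simp add: m field_simps)
qed

lemma weyl_act_fundamental_weight:
  assumes "\<pi> permutes {..<n}"
  shows "weyl_act n \<pi> (fundamental_weight n i) =
    vec n (\<lambda>k. of_bool (inv_into UNIV \<pi> k < i) - real i / real n)"
  using permutes_in_image[OF permutes_inv[OF assms]]
  by (intro eq_vecI) (auto simp: weyl_act_def fundamental_weight_def)

lemma weyl_act_eq_weyl_mat:
  assumes p: "\<pi> permutes {..<n}" and j: "j < n - 1"
  shows "weyl_act n \<pi> (fundamental_weight n (j + 1)) =
    vec n (\<lambda>k. \<Sum>i<n - 1. of_int (weyl_mat n \<pi> $$ (i, j)) * fundamental_weight n (i + 1) $ k)"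
proof -
  let ?u = "\<lambda>k. of_bool (inv_into UNIV \<pi> k < j + 1) - real (j + 1) / real n"
  have "(\<Sum>k<n. of_bool (inv_into UNIV \<pi> k < j + 1) :: real) = (\<Sum>k<n. of_bool (k < j + 1))"
    using sum.permute[OF permutes_inv[OF p], of "\<lambda>k. of_bool (k < j + 1) :: real"]
    by (simp only: o_def)
  also have "\<dots> = real (j + 1)"
  proof -
    have "{..<n} \<inter> {k. k < j + 1} = {..<j + 1}" using j by auto
    then show ?thesis by (simp add: of_bool_def sum.If_cases)
  qed
  finally have "(\<Sum>k<n. ?u k) = 0" using j by (simp add: sum_subtractf)
  note exp = fundamental_weight_expansion[OF _ this]
  have "(\<Sum>i<n - 1. of_int (weyl_mat n \<pi> $$ (i, j)) * fundamental_weight n (i + 1) $ k) =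
      (\<Sum>i<n - 1. (?u i - ?u (i + 1)) * fundamental_weight n (i + 1) $ k)" for k
    using j by (intro sum.cong) (auto simp: weyl_mat_def)
  then show ?thesis
    unfolding weyl_act_fundamental_weight[OF p] using exp by (intro eq_vecI) auto
qed

lemma weyl_integer_rep_eq: "weyl_integer_rep n = weyl_mat n ` {\<pi>. \<pi> permutes {..<n}}"
proof -
  have "B = weyl_mat n \<pi>"
    if p: "\<pi> permutes {..<n}" and B: "B \<in> carrier_mat (n - 1) (n - 1)"
      and eq: "\<forall>j<n - 1. weyl_act n \<pi> (fundamental_weight n (j + 1)) =
        vec n (\<lambda>k. \<Sum>i<n - 1. of_int (B $$ (i, j)) * fundamental_weight n (i + 1) $ k)" for \<pi> B
  proof (rule eq_matI)
    let ?A = "weyl_mat n \<pi>"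
    fix i j assume "i < dim_row ?A" "j < dim_col ?A"
    then have ij: "i < n - 1" "j < n - 1" by (auto simp: weyl_mat_def)
    let ?s = "\<lambda>B k. \<Sum>i<n - 1. of_int (B $$ (i, j)) * fundamental_weight n (i + 1) $ k"
    have vec_eq: "vec n (?s B) = vec n (?s ?A)"
      using eq weyl_act_eq_weyl_mat[OF p] ij by simp
    have s: "?s B k = ?s ?A k" if "k < n" for k
      using arg_cong[OF vec_eq, of "\<lambda>v. v $ k"] that by (simp only: index_vec)
    have "real_of_int (B $$ (i,j)) = of_int (?A $$ (i,j))"
      using sum_fundamental_weight_coroot[of i n "\<lambda>i. of_int (B $$ (i,j))"]
        sum_fundamental_weight_coroot[of i n "\<lambda>i. of_int (?A $$ (i,j))"]
        s[of i] s[of "i + 1"] ij by simp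
    then show "B $$ (i,j) = ?A $$ (i,j)" by linarith
  qed (use B in \<open>auto simp: weyl_mat_def\<close>)
  moreover have "weyl_mat n \<pi> \<in> carrier_mat (n - 1) (n - 1)" for \<pi> by (simp add: weyl_mat_def)
  ultimately show ?thesis
    unfolding weyl_integer_rep_def using weyl_act_eq_weyl_mat by blast
qed

lemma inj_on_weyl_mat: "inj_on (weyl_mat n) {\<pi>. \<pi> permutes {..<n}}"
proof (rule inj_onI, clarify)
  fix \<pi> \<sigma> assume p: "\<pi> permutes {..<n}" and s: "\<sigma> permutes {..<n}"
    and eq: "weyl_mat n \<pi> = weyl_mat n \<sigma>"
  let ?p = "inv_into UNIV \<pi>" and ?s = "inv_into UNIV \<sigma>"
  have lt: "?p k < j + 1 \<longleftrightarrow> ?s k < j + 1" if j: "j < n - 1" and k: "k < n" for j k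
  proof -
    have "vec n (\<lambda>k. of_bool (?p k < j + 1) - real (j + 1) / real n) =
        vec n (\<lambda>k. of_bool (?s k < j + 1) - real (j + 1) / real n)"
      using weyl_act_eq_weyl_mat[OF p j] weyl_act_eq_weyl_mat[OF s j] eq
      unfolding weyl_act_fundamental_weight[OF p] weyl_act_fundamental_weight[OF s] by simp
    from arg_cong[OF this, of "\<lambda>v. v $ k"] k
    show ?thesis by (simp add: of_bool_def split: if_splits)
  qed
  have "?p k = ?s k" for k
  proof (cases "k < n")
    case True
    then have *: "?p k < n" "?s k < n"
      using permutes_in_image[OF permutes_inv[OF p]] permutes_in_image[OF permutes_inv[OF s]] by auto
    show ?thesis
    proof (cases "?p k" "?s k" rule: linorder_cases)
      case less
      then have "?p k < n - 1" using * by linarith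
      then show ?thesis using lt[of "?p k" k] True less by simp
    next
      case greater
      then have "?s k < n - 1" using * by linarith
      then show ?thesis using lt[of "?s k" k] True greater by simp
    qed simp
  next
    case False
    then show ?thesis
      using permutes_not_in[OF permutes_inv[OF p], of k] permutes_not_in[OF permutes_inv[OF s], of k]
      by simp
  qed
  then have "?p = ?s" by (rule ext)
  then have "inv_into UNIV ?p = inv_into UNIV ?s" by (rule arg_cong)
  then show "\<pi> = \<sigma>"
    by (simp only: permutes_inv_inv[OF p] permutes_inv_inv[OF s])
qed

text \<open>The paper's coordinates \<open>x\<close> are attached to the fundamental weights; passing to the quotients
  of consecutive coordinates attaches one variable to each \<open>\<epsilon>\<^sub>k\<close>.\<close>

definition partial_prods :: "nat \<Rightarrow> (nat \<Rightarrow> complex) \<Rightarrow> complex vec" where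
  "partial_prods n y = vec (n - 1) (\<lambda>i. \<Prod>k\<le>i. y k)"

lemma partial_prods_surj:
  assumes x: "x \<in> compact_torus (n - 1)" and n: "n \<ge> 2"
  obtains y where "\<And>k. k < n \<Longrightarrow> cmod (y k) = 1" "(\<Prod>k<n. y k) = 1" "x = partial_prods n y"
proof -
  obtain m where m: "n = Suc m" "m \<ge> 1" using n by (cases n) auto
  define X where "X k = (if k = 0 \<or> k = n then 1 else x $ (k - 1))" for k
  define y where "y k = X (Suc k) / X k" for k
  have X1: "cmod (X k) = 1" if "k \<le> n" for k
    using x that by (auto simp: X_def compact_torus_def)
  then have X0: "X k \<noteq> 0" if "k \<le> n" for k
    using that by (metis norm_zero zero_neq_one)
  have prod: "(\<Prod>l<k. y l) = X k" if "k \<le> n" for k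
    using that by (induction k) (auto simp: y_def X0, auto simp: X_def)
  show ?thesis
  proof
    show "cmod (y k) = 1" if "k < n" for k
      using X1[of k] X1[of "Suc k"] that by (simp add: y_def norm_divide)
    show "(\<Prod>k<n. y k) = 1" using prod[of n] by (simp add: X_def)
    show "x = partial_prods n y"
    proof (rule eq_vecI)
      fix i assume "i < dim_vec (partial_prods n y)"
      then have i: "i < n - 1" by (simp add: partial_prods_def)
      then show "x $ i = partial_prods n y $ i"
        using prod[of "Suc i"] by (simp add: partial_prods_def lessThan_Suc_atMost X_def)
    qed (use x in \<open>simp add: partial_prods_def compact_torus_def\<close>)
  qed
qed

lemma partial_prods_in_torus:
  assumes "\<And>k. k < n \<Longrightarrow> cmod (y k) = 1"
  shows "partial_prods n y \<in> compact_torus (n - 1)"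
  using assms by (auto simp: partial_prods_def compact_torus_def prod_norm[symmetric] intro!: prod.neutral)

lemma laurent_monom_partial_prods:
  assumes p: "\<pi> permutes {..<n}" and j: "j < n - 1"
    and y0: "\<And>k. k < n \<Longrightarrow> y k \<noteq> 0" and y1: "(\<Prod>k<n. y k) = 1"
  shows "laurent_monom (partial_prods n y) (weyl_mat n \<pi> *\<^sub>v unit_vec (n - 1) j) =
    (\<Prod>k\<in>\<pi> ` {..<j + 1}. y k)"
proof -
  obtain m where m: "n = Suc m" using j by (cases n) auto
  define X where "X k = (\<Prod>l<k. y l)" for k
  define b :: "nat \<Rightarrow> int" where "b k = of_bool (inv_into UNIV \<pi> k < j + 1)" for k
  have X0: "X k \<noteq> 0" if "k \<le> n" for k
    using y0 that by (auto simp: X_def)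
  have col: "(weyl_mat n \<pi> *\<^sub>v unit_vec (n - 1) j) $ i = b i - b (i + 1)" if "i < n - 1" for i
    using that j by (simp add: weyl_mat_def b_def)
  have "laurent_monom (partial_prods n y) (weyl_mat n \<pi> *\<^sub>v unit_vec (n - 1) j) =
      (\<Prod>i<m. X (Suc i) powi (b i - b (Suc i)))"
    unfolding laurent_monom_def
    using col by (intro prod.cong) (auto simp: partial_prods_def X_def m lessThan_Suc_atMost)
  also have "\<dots> = (\<Prod>i<m. X (Suc i) powi b i) / (\<Prod>i<m. X (Suc i) powi b (Suc i))"
    unfolding prod_dividef[symmetric] using X0 m
    by (intro prod.cong) (auto simp: power_int_diff)
  also have "(\<Prod>i<m. X (Suc i) powi b i) = (\<Prod>i<n. X (Suc i) powi b i)"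
    using y1 by (simp add: m X_def)
  also have "(\<Prod>i<m. X (Suc i) powi b (Suc i)) = (\<Prod>i<n. X i powi b i)"
    unfolding m prod.lessThan_Suc_shift by (simp add: X_def)
  also have "(\<Prod>i<n. X (Suc i) powi b i) / (\<Prod>i<n. X i powi b i) = (\<Prod>i<n. y i powi b i)"
    unfolding prod_dividef[symmetric]
  proof (intro prod.cong refl)
    fix i assume "i \<in> {..<n}"
    then have "X i \<noteq> 0" using X0 by simp
    moreover have "X (Suc i) = X i * y i" by (simp add: X_def)
    ultimately show "X (Suc i) powi b i / X i powi b i = y i powi b i"
      by (simp add: power_int_mult_distrib)
  qed
  also have "\<dots> = (\<Prod>i | i \<in> {..<n} \<and> inv_into UNIV \<pi> i < j + 1. y i)"
    unfolding prod.inter_filter[OF finite_lessThan] by (intro prod.cong) (auto simp: b_def)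
  also have "{i. i \<in> {..<n} \<and> inv_into UNIV \<pi> i < j + 1} = \<pi> ` {..<j + 1}"
  proof (intro subset_antisym subsetI)
    fix i assume "i \<in> {i. i \<in> {..<n} \<and> inv_into UNIV \<pi> i < j + 1}"
    then have "\<pi> (inv_into UNIV \<pi> i) \<in> \<pi> ` {..<j + 1}" by (intro imageI) simp
    then show "i \<in> \<pi> ` {..<j + 1}" by (simp only: permutes_inverses(1)[OF p])
  next
    fix i assume "i \<in> \<pi> ` {..<j + 1}"
    then obtain l where l: "i = \<pi> l" "l < j + 1" by blast
    have "inv_into UNIV \<pi> i = l" unfolding l(1) by (rule permutes_inverses(2)[OF p])
    moreover have "l < n" using l(2) j by linarith
    then have "i < n" using permutes_in_image[OF p, of l] l(1) by simp
    ultimately show "i \<in> {i. i \<in> {..<n} \<and> inv_into UNIV \<pi> i < j + 1}" using l(2) by simp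
  qed
  finally show ?thesis .
qed

lemma fundamental_invariant_partial_prods:
  assumes i: "1 \<le> i" "i \<le> n - 1"
    and y: "\<And>k. k < n \<Longrightarrow> y k \<noteq> 0" "(\<Prod>k<n. y k) = 1"
  shows "of_nat (n choose i) * fundamental_invariant n i (partial_prods n y) = esym n i y"
proof -
  let ?P = "{\<pi>. \<pi> permutes {..<n}}"
  have "card (weyl_integer_rep n) = fact n"
    unfolding weyl_integer_rep_eq card_image[OF inj_on_weyl_mat]
    using card_permutations[of "{..<n}" n] by simp
  moreover have "(\<Sum>B\<in>weyl_integer_rep n. laurent_monom (partial_prods n y) (B *\<^sub>v unit_vec (n - 1) (i - 1))) =
      (\<Sum>\<pi>\<in>?P. \<Prod>k\<in>\<pi> ` {..<i}. y k)"
    unfolding weyl_integer_rep_eq sum.reindex[OF inj_on_weyl_mat] o_def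
    using laurent_monom_partial_prods[of _ n "i - 1" y] i y by (intro sum.cong) auto
  ultimately have "of_nat (n choose i) * fundamental_invariant n i (partial_prods n y) =
      (1 / fact n) * (of_nat (n choose i) * (\<Sum>\<pi>\<in>?P. \<Prod>k\<in>\<pi> ` {..<i}. y k))"
    by (simp add: fundamental_invariant_def)
  also have "\<dots> = esym n i y"
    using i by (subst sum_permutations_prod_eq_esym) auto
  finally show ?thesis .
qed

lemma orbit_space_eq_esym:
  assumes n: "n \<ge> 2"
  shows "orbit_space n = {z \<in> carrier_vec (n - 1). \<exists>y. (\<forall>k<n. cmod (y k) = 1) \<and> (\<Prod>k<n. y k) = 1 \<and>
    (\<forall>i\<in>{1..n - 1}. of_nat (n choose i) * zcoord n z i = esym n i y)}"
    (is "_ = ?R")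
proof (intro subset_antisym subsetI)
  fix z assume "z \<in> orbit_space n"
  then obtain x where x: "x \<in> compact_torus (n - 1)"
    and z: "z = vec (n - 1) (\<lambda>k. fundamental_invariant n (k + 1) x)"
    by (auto simp: orbit_space_def)
  obtain y where y: "\<And>k. k < n \<Longrightarrow> cmod (y k) = 1" "(\<Prod>k<n. y k) = 1" "x = partial_prods n y"
    using partial_prods_surj[OF x n] by blast
  have y0: "y k \<noteq> 0" if "k < n" for k using y(1)[OF that] by (metis norm_zero zero_neq_one)
  have "of_nat (n choose i) * zcoord n z i = esym n i y" if "i \<in> {1..n - 1}" for i
  proof -
    have "i - 1 < n - 1" "1 \<le> i" "i \<le> n - 1" "i \<noteq> n" using that n by auto
    then have "zcoord n z i = fundamental_invariant n i (partial_prods n y)"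
      by (simp add: zcoord_def z y(3))
    then show ?thesis
      using fundamental_invariant_partial_prods[OF \<open>1 \<le> i\<close> \<open>i \<le> n - 1\<close> y0 y(2)] by simp
  qed
  moreover have "z \<in> carrier_vec (n - 1)" by (simp add: z)
  ultimately show "z \<in> ?R" using y(1,2) by blast
next
  fix z assume "z \<in> ?R"
  then obtain y where z: "z \<in> carrier_vec (n - 1)"
    and y: "\<forall>k<n. cmod (y k) = 1" "(\<Prod>k<n. y k) = 1"
    and e: "\<forall>i\<in>{1..n - 1}. of_nat (n choose i) * zcoord n z i = esym n i y"
    by blast
  have y0: "y k \<noteq> 0" if "k < n" for k using y(1) that by (metis norm_zero zero_neq_one)
  have "z = vec (n - 1) (\<lambda>k. fundamental_invariant n (k + 1) (partial_prods n y))"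
  proof (rule eq_vecI)
    fix k assume "k < dim_vec (vec (n - 1) (\<lambda>k. fundamental_invariant n (k + 1) (partial_prods n y)))"
    then have k: "k < n - 1" by simp
    then have "zcoord n z (k + 1) = z $ k" by (simp add: zcoord_def)
    then have "of_nat (n choose (k + 1)) * z $ k = esym n (k + 1) y"
      using k bspec[OF e, of "k + 1"] by simp
    also have "\<dots> = of_nat (n choose (k + 1)) * fundamental_invariant n (k + 1) (partial_prods n y)"
      using k y0 y(2) by (intro fundamental_invariant_partial_prods[symmetric]) auto
    finally have "z $ k = fundamental_invariant n (k + 1) (partial_prods n y)"
      using k by (auto simp only: mult_cancel_left of_nat_eq_0_iff binomial_eq_0_iff)
    then show "z $ k = vec (n - 1) (\<lambda>k. fundamental_invariant n (k + 1) (partial_prods n y)) $ k"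
      using k by simp
  qed (use z in simp)
  moreover have "partial_prods n y \<in> compact_torus (n - 1)"
    using y(1) by (intro partial_prods_in_torus) simp
  ultimately show "z \<in> orbit_space n"
    unfolding orbit_space_def by (rule image_eqI)
qed

lemma esym_0: "esym n 0 y = 1"
proof -
  have "{J. J \<subseteq> {..<n} \<and> card J = 0} = {{}}"
    by (auto simp: card_eq_0_iff dest: finite_subset)
  then show ?thesis by (simp add: esym_def)
qed

lemma esym_top: "esym n n y = (\<Prod>k<n. y k)"
proof -
  have "{J. J \<subseteq> {..<n} \<and> card J = n} = {{..<n}}"
    by (auto dest: card_subset_eq[OF finite_lessThan])
  then show ?thesis by (simp add: esym_def)
qed

lemma prod_linear_eq_esym:
  "(\<Prod>k<n. [:1, - y k:]) = (\<Sum>i\<le>n. monom ((- 1) ^ i * esym n i y) i)"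
proof -
  let ?h = "\<lambda>J. monom ((- 1) ^ card J * prod y J) (card J)"
  have m: "(\<Prod>k\<in>J. monom (- y k) 1) = ?h J" if "finite J" for J
    using that by (induction J) (simp_all add: mult_monom)
  have "(\<Prod>k<n. [:1, - y k:]) = (\<Prod>k<n. monom (- y k) 1 + 1)"
    by (simp add: monom_altdef one_pCons)
  also have "\<dots> = (\<Sum>J\<in>Pow {..<n}. \<Prod>k\<in>J. monom (- y k) 1)"
    by (simp add: prod_add)
  also have "\<dots> = (\<Sum>J\<in>Pow {..<n}. ?h J)"
    by (intro sum.cong refl m) (auto intro: finite_subset)
  also have "\<dots> = (\<Sum>i\<le>n. \<Sum>J | J \<in> Pow {..<n} \<and> card J = i. ?h J)"
    by (rule sum.group[symmetric]) (auto dest: card_mono[OF finite_lessThan])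
  also have "\<dots> = (\<Sum>i\<le>n. monom ((- 1) ^ i * esym n i y) i)"
    by (intro sum.cong refl) (simp add: esym_def sum_distrib_left monom_sum)
  finally show ?thesis .
qed

lemma cnj_esym:
  assumes y: "\<And>k. k < n \<Longrightarrow> cmod (y k) = 1" "(\<Prod>k<n. y k) = 1" and i: "i \<le> n"
  shows "cnj (esym n i y) = esym n (n - i) y"
proof -
  have inv: "cnj (y k) * y k = 1" if "k < n" for k
    using y(1)[OF that] complex_norm_square[of "y k"] by (simp add: mult.commute)
  have "cnj (prod y J) = prod y ({..<n} - J)" if J: "J \<subseteq> {..<n}" for J
  proof -
    have "cnj (prod y J) * prod y J = (\<Prod>k\<in>J. cnj (y k) * y k)"
      by (simp add: prod.distrib)
    also have "\<dots> = 1" using J inv by (intro prod.neutral) auto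
    finally have "cnj (prod y J) * prod y J = 1" .
    moreover have "prod y ({..<n} - J) * prod y J = 1"
      using prod.subset_diff[OF J, of y] y(2) by simp
    ultimately show ?thesis by (metis mult_cancel_right mult_zero_right zero_neq_one)
  qed
  then have "cnj (esym n i y) = (\<Sum>J | J \<subseteq> {..<n} \<and> card J = i. prod y ({..<n} - J))"
    by (simp add: esym_def cnj_sum)
  also have "\<dots> = esym n (n - i) y"
    unfolding esym_def
    by (rule sum.reindex_bij_witness[of _ "\<lambda>J. {..<n} - J" "\<lambda>J. {..<n} - J"])
      (use i in \<open>auto simp: card_Diff_subset finite_subset[OF _ finite_lessThan] double_diff\<close>)
  finally show ?thesis .
qed

lemma ex_root_coordinates:
  assumes n: "n \<ge> 1"
  obtains y where "\<And>k. k < n \<Longrightarrow> y k \<noteq> 0" "(\<Prod>k<n. y k) = 1"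
    "\<And>i. i \<le> n \<Longrightarrow> of_nat (n choose i) * zcoord n z i = esym n i y"
proof -
  define q where "q = (\<Sum>i\<le>n. monom ((- 1) ^ i * (of_nat (n choose i) * zcoord n z i)) i)"
  have coeff_q: "coeff q i = (if i \<le> n then (- 1) ^ i * (of_nat (n choose i) * zcoord n z i) else 0)" for i
    by (simp add: q_def coeff_sum)
  have "coeff q n = (- 1) ^ n" by (simp add: coeff_q zcoord_def)
  then have deg: "degree q = n"
    by (intro antisym degree_le le_degree) (auto simp: coeff_q)
  from fundamental_theorem_algebra_factorized[of q] obtain as where
    as: "smult (coeff q (degree q)) (\<Prod>a\<leftarrow>as. [:- a, 1:]) = q" "length as = degree q" by blast
  define a where "a k = as ! k" for k
  have "(\<Prod>a\<leftarrow>as. [:- a, 1:]) = (\<Prod>k<n. [:- a k, 1:])"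
    using as(2) deg by (simp add: prod.list_conv_set_nth lessThan_atLeast0 a_def)
  with as(1) have q: "q = smult ((- 1) ^ n) (\<Prod>k<n. [:- a k, 1:])"
    using deg by (simp add: coeff_q zcoord_def)
  have "poly q 0 = 1" by (simp add: poly_0_coeff_0 coeff_q zcoord_def)
  then have sgn: "(- 1) ^ n * (\<Prod>k<n. - a k) = 1" by (simp add: q poly_prod)
  then have a1: "(\<Prod>k<n. a k) = 1" by (simp add: prod_uminus flip: power_mult_distrib mult.assoc)
  then have a0: "a k \<noteq> 0" if "k < n" for k using that by (metis finite_lessThan lessThan_iff prod_zero zero_neq_one)
  define y where "y k = 1 / a k" for k
  have "(\<Prod>k<n. [:- a k, 1:]) = (\<Prod>k<n. smult (- a k) [:1, - y k:])"
    using a0 by (intro prod.cong) (auto simp: y_def)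
  also have "\<dots> = smult (\<Prod>k<n. - a k) (\<Prod>k<n. [:1, - y k:])"
    by (rule prod_smult)
  finally have "q = (\<Prod>k<n. [:1, - y k:])" using sgn by (simp add: q)
  then have e: "q = (\<Sum>i\<le>n. monom ((- 1) ^ i * esym n i y) i)" by (simp add: prod_linear_eq_esym)
  show ?thesis
  proof
    show "y k \<noteq> 0" if "k < n" for k using a0[OF that] by (simp add: y_def)
    show "(\<Prod>k<n. y k) = 1" using a1 by (simp add: y_def prod_dividef)
    show "of_nat (n choose i) * zcoord n z i = esym n i y" if "i \<le> n" for i
    proof -
      have "coeff q i = (- 1) ^ i * esym n i y"
        using that unfolding e by (simp add: coeff_sum)
      then show ?thesis using that by (simp add: coeff_q)
    qed
  qed
qed

subsection \<open>Eigenvalues of \<open>C(z)\<close>\<close>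

lemma mult_reciprocal_eq_autocorrelation:
  fixes t s :: "'a :: comm_ring_1"
  assumes ts: "t * s = 1"
  shows "(\<Sum>i\<le>n. a i * t ^ i) * (\<Sum>i\<le>n. a i * s ^ i) =
    (\<Sum>i\<le>n. a i * a i) + (\<Sum>k = 1..n. (\<Sum>i\<le>n - k. a i * a (i + k)) * (t ^ k + s ^ k))"
proof (induction n)
  case 0
  then show ?case by simp
next
  case (Suc n)
  let ?g = "\<lambda>k. a (Suc n - k) * a (Suc n) * (t ^ k + s ^ k)"
  have red: "t ^ Suc n * s ^ i = t ^ (Suc n - i)" "s ^ Suc n * t ^ i = s ^ (Suc n - i)" if "i \<le> n" for i
  proof -
    have p: "t ^ i * s ^ i = 1" using ts by (simp flip: power_mult_distrib)
    have "t ^ Suc n = t ^ (Suc n - i) * t ^ i" "s ^ Suc n = s ^ (Suc n - i) * s ^ i"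
      using that by (simp_all flip: power_add)
    then show "t ^ Suc n * s ^ i = t ^ (Suc n - i)" "s ^ Suc n * t ^ i = s ^ (Suc n - i)"
      using p by (simp_all only: mult.assoc mult.commute[of "s ^ i"] mult_1_right)
  qed
  have "(\<Sum>k = 1..Suc n. (\<Sum>i\<le>Suc n - k. a i * a (i + k)) * (t ^ k + s ^ k)) =
      (\<Sum>k = 1..n. (\<Sum>i\<le>n - k. a i * a (i + k)) * (t ^ k + s ^ k)) + (\<Sum>k = 1..Suc n. ?g k)"
  proof -
    have "(\<Sum>i\<le>Suc n - k. a i * a (i + k)) = (\<Sum>i\<le>n - k. a i * a (i + k)) + a (Suc n - k) * a (Suc n)"
      if "k \<in> {1..n}" for k
      using that by (simp add: Suc_diff_le)
    then show ?thesis by (simp add: distrib_right sum.distrib)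
  qed
  also have "(\<Sum>k = 1..Suc n. ?g k) = (\<Sum>i\<le>n. a i * a (Suc n) * (t ^ (Suc n - i) + s ^ (Suc n - i)))"
    by (rule sum.reindex_bij_witness[of _ "\<lambda>i. Suc n - i" "\<lambda>k. Suc n - k"]) auto
  also have "\<dots> = a (Suc n) * t ^ Suc n * (\<Sum>i\<le>n. a i * s ^ i) + a (Suc n) * s ^ Suc n * (\<Sum>i\<le>n. a i * t ^ i)"
    unfolding sum_distrib_left sum.distrib[symmetric]
  proof (intro sum.cong refl)
    fix i assume "i \<in> {..n}"
    then have "i \<le> n" by simp
    note red[OF this, symmetric]
    then show "a i * a (Suc n) * (t ^ (Suc n - i) + s ^ (Suc n - i)) =
        a (Suc n) * t ^ Suc n * (a i * s ^ i) + a (Suc n) * s ^ Suc n * (a i * t ^ i)"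
      by (simp add: algebra_simps)
  qed
  finally have rhs: "(\<Sum>k = 1..Suc n. (\<Sum>i\<le>Suc n - k. a i * a (i + k)) * (t ^ k + s ^ k)) =
      (\<Sum>k = 1..n. (\<Sum>i\<le>n - k. a i * a (i + k)) * (t ^ k + s ^ k)) +
      (a (Suc n) * t ^ Suc n * (\<Sum>i\<le>n. a i * s ^ i) + a (Suc n) * s ^ Suc n * (\<Sum>i\<le>n. a i * t ^ i))" .
  have "t ^ Suc n * s ^ Suc n = 1" unfolding power_mult_distrib[symmetric] ts by (rule power_one)
  then have "(a (Suc n) * t ^ Suc n) * (a (Suc n) * s ^ Suc n) = a (Suc n) * a (Suc n)"
    by (metis mult.assoc mult.left_commute mult_1_right)
  then show ?case
    unfolding rhs using Suc.IH by (simp add: algebra_simps del: power_Suc)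
qed

lemma dpoly_eq_autocorrelation:
  fixes z :: "complex vec"
  assumes k: "k \<le> n"
  defines "a \<equiv> \<lambda>i. (- 1) ^ i * (of_nat (n choose i) * zcoord n z i)"
  shows "dpoly n (n - k) z = (- 1) ^ n * (\<Sum>i\<le>n - k. a i * a (i + k))"
proof -
  have sgn: "(- 1 :: complex) ^ (n - k) = (- 1) ^ n * (- 1) ^ k"
    using k by (auto simp: minus_one_power_iff)
  have "of_nat (n choose i) * of_nat (n choose (n - k - i)) * zcoord n z i * zcoord n z (n - (n - k) + i) =
      (- 1) ^ k * (a i * a (i + k))" if "i \<in> {0..n - k}" for i
  proof -
    have "i \<le> n - k" using that by simp
    then
 have "n choose (n - k - i) = n choose (i + k)"
      using k binomial_symmetric[of "i + k" n] by (simp add: add.commute)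
    moreover have "n - (n - k) + i = i + k" using k by simp
    moreover have "(- 1 :: complex) ^ k * ((- 1) ^ i * (- 1) ^ (i + k)) = 1"
      by (simp add: minus_one_power_iff)
    moreover have "(- 1) ^ k * (a i * a (i + k)) = ((- 1) ^ k * ((- 1) ^ i * (- 1) ^ (i + k))) *
        (of_nat (n choose i) * of_nat (n choose (i + k)) * zcoord n z i * zcoord n z (i + k))"
      unfolding a_def by (simp only: mult_ac)
    ultimately show ?thesis by (simp only: mult_1_left)
  qed
  note eq = sum.cong[OF refl this]
  have "dpoly n (n - k) z = (- 1) ^ n * (- 1) ^ k * (\<Sum>i = 0..n - k. (- 1) ^ k * (a i * a (i + k)))"
    unfolding dpoly_def sgn by (rule arg_cong[OF eq])
  also have "\<dots> = (- 1) ^ n * ((- 1) ^ k * (- 1) ^ k) * (\<Sum>i\<le>n - k. a i * a (i + k))"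
    by (simp only: sum_distrib_left[symmetric] mult.assoc atMost_atLeast0)
  also have "(- 1 :: complex) ^ k * (- 1) ^ k = 1"
    by (simp flip: power_mult_distrib)
  finally show ?thesis by simp
qed

lemma char_poly_C_mat:
  assumes n: "n \<ge> 3" and y: "\<And>k. k < n \<Longrightarrow> y k \<noteq> 0" "(\<Prod>k<n. y k) = 1"
    and e: "\<And>i. i \<le> n \<Longrightarrow> of_nat (n choose i) * zcoord n z i = esym n i y"
  shows "char_poly (C_mat n z) = (\<Prod>k<n. [:- ((y k + 1 / y k) / 2), 1:])"
proof -
  let ?P = "\<Prod>k<n. [:- ((y k + 1 / y k) / 2), 1:]"
  define a where "a i = (- 1) ^ i * (of_nat (n choose i) * zcoord n z i)" for i
  have d0: "dpoly n 0 z = 1" by (simp add: dpoly_def zcoord_def)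
  have "poly (smult 4 (comrade_poly n z)) x = poly (smult (2 ^ n) ?P) x" for x
  proof -
    define t where "t = x + csqrt (x\<^sup>2 - 1)"
    define s where "s = x - csqrt (x\<^sup>2 - 1)"
    have ts: "t * s = 1"
      using power2_csqrt[of "x\<^sup>2 - 1"] by (simp add: t_def s_def algebra_simps power2_eq_square)
    have x: "x = (t + s) / 2" by (simp add: t_def s_def)
    have lin: "(\<Sum>i\<le>n. a i * u ^ i) = (\<Prod>k<n. 1 - y k * u)" for u
    proof -
      have "poly (\<Prod>k<n. [:1, - y k:]) u = (\<Sum>i\<le>n. a i * u ^ i)"
        unfolding prod_linear_eq_esym using e by (simp add: poly_sum poly_monom a_def)
      then show ?thesis by (simp add: poly_prod mult.commute)
    qed
    have "poly (smult 4 (comrade_poly n z)) x =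
        dpoly n n z + (\<Sum>i = 1..<n. dpoly n (n - i) z * (t ^ i + s ^ i)) + (t ^ n + s ^ n)"
      unfolding x by (simp add: comrade_poly_def poly_sum poly_chebyshev_joukowski[OF ts] sum_distrib_left)
    also have "\<dots> = dpoly n n z + (\<Sum>k = 1..n. dpoly n (n - k) z * (t ^ k + s ^ k))"
    proof -
      have "{1..n} = insert n {1..<n}" using n by auto
      then show ?thesis by (simp add: d0)
    qed
    also have "\<dots> = (- 1) ^ n * ((\<Sum>i\<le>n. a i * a i) +
        (\<Sum>k = 1..n. (\<Sum>i\<le>n - k. a i * a (i + k)) * (t ^ k + s ^ k)))"
    proof -
      have d: "dpoly n (n - k) z = (- 1) ^ n * (\<Sum>i\<le>n - k. a i * a (i + k))" if "k \<le> n" for k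
        using dpoly_eq_autocorrelation[OF that, of z] by (simp only: a_def)
      have "(\<Sum>k = 1..n. dpoly n (n - k) z * (t ^ k + s ^ k)) =
          (- 1) ^ n * (\<Sum>k = 1..n. (\<Sum>i\<le>n - k. a i * a (i + k)) * (t ^ k + s ^ k))"
        unfolding sum_distrib_left[of "(- 1) ^ n" _ "{1..n}"]
        by (intro sum.cong refl) (simp only: d atLeastAtMost_iff mult.assoc)
      then show ?thesis using d[of 0] by (simp add: distrib_left)
    qed
    also have "\<dots> = (- 1) ^ n * (\<Prod>k<n. (1 - y k * t) * (1 - y k * s))"
      unfolding mult_reciprocal_eq_autocorrelation[OF ts, symmetric] lin prod.distrib ..
    also have "(\<Prod>k<n. (1 - y k * t) * (1 - y k * s)) =
        (\<Prod>k<n. - 2 * y k * (x - (y k + 1 / y k) / 2))"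
    proof (intro prod.cong refl)
      fix k assume "k \<in> {..<n}"
      then have "y k \<noteq> 0" using y by simp
      then have "- 2 * y k * (x - (y k + 1 / y k) / 2) = y k * y k * (t * s) - y k * (t + s) + 1"
        unfolding ts by (simp add: x field_simps)
      then show "(1 - y k * t) * (1 - y k * s) = - 2 * y k * (x - (y k + 1 / y k) / 2)"
        by (simp add: algebra_simps)
    qed
    also have "\<dots> = (- 2) ^ n * (\<Prod>k<n. x - (y k + 1 / y k) / 2)"
      unfolding prod.distrib y(2) by simp
    also have "(- 1) ^ n * \<dots> = 2 ^ n * (\<Prod>k<n. x - (y k + 1 / y k) / 2)"
      by (simp flip: mult.assoc power_mult_distrib)
    also have "\<dots> = poly (smult (2 ^ n) ?P) x"
      by (simp add: poly_prod)
    finally show ?thesis .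
  qed
  then have "smult 4 (comrade_poly n z) = smult (2 ^ n) ?P"
    by (intro poly_eq_poly_eq_iff[THEN iffD1] ext)
  then have "smult (2 ^ n) (char_poly (C_mat n z)) = smult (2 ^ n) ?P"
    by (simp add: char_poly_C_mat_comrade[OF n])
  from arg_cong[OF this, of "smult (1 / 2 ^ n)"] show ?thesis by simp
qed

subsection \<open>The Hermite form\<close>

lemma cnj_zcoord:
  assumes "z \<in> conj_space n" "i \<le> n"
  shows "cnj (zcoord n z i) = zcoord n z (n - i)"
proof (cases "i = 0 \<or> i = n")
  case False
  then have "i \<in> {1..n - 1}" using assms(2) by auto
  then show ?thesis using assms(1) by (simp add: conj_space_def)
qed (auto simp: zcoord_def)

lemma dpoly_real:
  assumes z: "z \<in> conj_space n" and l: "l \<le> n"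
  shows "dpoly n l z \<in> \<real>"
proof -
  let ?f = "\<lambda>i. of_nat (n choose i) * of_nat (n choose (l - i)) * zcoord n z i * zcoord n z (n - l + i)"
  have "cnj (\<Sum>i = 0..l. ?f i) = (\<Sum>i = 0..l. ?f (l - i))"
    unfolding cnj_sum
  proof (rule sum.cong[OF refl])
    fix i assume "i \<in> {0..l}"
    then have i: "i \<le> l" by simp
    have "cnj (zcoord n z i) = zcoord n z (n - i)" "cnj (zcoord n z (n - l + i)) = zcoord n z (l - i)"
      using cnj_zcoord[OF z, of i] cnj_zcoord[OF z, of "n - l + i"] i l by auto
    moreover have "l - (l - i) = i" "n - l + (l - i) = n - i" using i l by auto
    ultimately show "cnj (?f i) = ?f (l - i)" by (simp add: mult_ac)
  qed
  also have "\<dots> = (\<Sum>i = 0..l. ?f i)"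
    using sum.atLeastAtMost_rev[of ?f 0 l] by simp
  finally have "(\<Sum>i = 0..l. ?f i) \<in> \<real>" by (simp only: Reals_cnj_iff)
  moreover have "(- 1 :: complex) ^ l \<in> \<real>" by simp
  ultimately show ?thesis unfolding dpoly_def by (rule Reals_mult[rotated])
qed

lemma C_mat_eq_of_real:
  assumes n: "n \<ge> 3" and z: "z \<in> conj_space n"
  shows "C_mat n z = map_mat of_real (map_mat Re (C_mat n z))"
proof (rule eq_matI)
  let ?R = "map_mat complex_of_real (map_mat Re (C_mat n z))"
  fix i j assume "i < dim_row ?R" "j < dim_col ?R"
  then have ij: "i < n" "j < n" by (auto simp: C_mat_def)
  have half: "a \<in> \<real> \<Longrightarrow> a / 2 \<in> \<real>" "a \<in> \<real> \<Longrightarrow> a / 4 \<in> \<real>" for a :: complex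
    by (intro Reals_divide; simp)+
  have "C_entry n z (i + 1) (j + 1) \<in> \<real>"
    using n ij dpoly_real[OF z, of n] dpoly_real[OF z, of 2] dpoly_real[OF z, of "n - i"] half
    by (auto simp: C_entry_def)
  then show "C_mat n z $$ (i, j) = ?R $$ (i, j)"
    using ij by (simp add: C_mat_def)
qed (auto simp: C_mat_def)

lemma H_mat_eq_mat_trace:
  assumes "i < n" "j < n"
  shows "H_mat n z $$ (i, j) = mat_trace (C_mat n z ^\<^sub>m (i + j)) - mat_trace (C_mat n z ^\<^sub>m (i + j + 2))"
proof -
  have C: "C_mat n z \<in> carrier_mat n n" by (simp add: C_mat_def)
  then have P: "C_mat n z ^\<^sub>m k \<in> carrier_mat n n" for k by simp
  show ?thesis
    using assms mat_trace_minus[OF P P] by (simp only: H_mat_def index_mat split_conv)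
qed

lemma H_mat_real:
  assumes n: "n \<ge> 3" and z: "z \<in> conj_space n" and ij: "i < n" "j < n"
  shows "H_mat n z $$ (i, j) \<in> \<real>"
proof -
  let ?R = "map_mat Re (C_mat n z)"
  have R: "?R \<in> carrier_mat n n" by (simp add: C_mat_def)
  have pow: "C_mat n z ^\<^sub>m k = map_mat of_real (?R ^\<^sub>m k)" for k
    unfolding of_real_hom.mat_hom_pow[OF R] C_mat_eq_of_real[OF n z, symmetric] ..
  have "?R ^\<^sub>m k \<in> carrier_mat n n" for k using R by simp
  then have "mat_trace (C_mat n z ^\<^sub>m k) = of_real (mat_trace (?R ^\<^sub>m k))" for k
    unfolding pow by (rule mat_trace_of_real)
  then have "mat_trace (C_mat n z ^\<^sub>m k) \<in> \<real>" for k by (simp only: Reals_of_real)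
  then show ?thesis unfolding H_mat_eq_mat_trace[OF ij] by (intro Reals_diff)
qed

lemma H_mat_eq_power_sum:
  assumes cp: "char_poly (C_mat n z) = (\<Prod>k<n. [:- c k, 1:])" and ij: "i < n" "j < n"
  shows "H_mat n z $$ (i, j) = (\<Sum>k<n. (1 - (c k)\<^sup>2) * (c k ^ i * c k ^ j))"
proof -
  have C: "C_mat n z \<in> carrier_mat n n" by (simp add: C_mat_def)
  show ?thesis
    unfolding H_mat_eq_mat_trace[OF ij] mat_trace_pow_eq_power_sum[OF C cp] sum_subtractf[symmetric]
    by (simp add: algebra_simps power_add power2_eq_square)
qed

lemma quadratic_form_H_mat:
  assumes cp: "char_poly (C_mat n z) = (\<Prod>k<n. [:- c k, 1:])" and v: "v \<in> carrier_vec n"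
  shows "v \<bullet> (map_mat Re (H_mat n z) *\<^sub>v v) =
    Re (\<Sum>k<n. (1 - (c k)\<^sup>2) * (\<Sum>i<n. of_real (v $ i) * c k ^ i)\<^sup>2)"
proof -
  let ?q = "\<lambda>k. \<Sum>i<n. of_real (v $ i) * c k ^ i"
  have H: "H_mat n z \<in> carrier_mat n n" by (simp add: H_mat_def)
  have "v \<bullet> (map_mat Re (H_mat n z) *\<^sub>v v) = (\<Sum>i<n. \<Sum>j<n. v $ i * (Re (H_mat n z $$ (i, j)) * v $ j))"
    using H v by (auto simp: scalar_prod_def lessThan_atLeast0 sum_distrib_left intro!: sum.cong)
  also have "\<dots> = (\<Sum>i<n. \<Sum>j<n. Re (\<Sum>k<n. (1 - (c k)\<^sup>2) * ((of_real (v $ i) * c k ^ i) * (of_real (v $ j) * c k ^ j))))"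
  proof (intro sum.cong refl)
    fix i j assume "i \<in> {..<n}" "j \<in> {..<n}"
    then have H: "H_mat n z $$ (i, j) = (\<Sum>k<n. (1 - (c k)\<^sup>2) * (c k ^ i * c k ^ j))"
      using H_mat_eq_power_sum[OF cp] by simp
    have "v $ i * (Re (H_mat n z $$ (i, j)) * v $ j) = Re (of_real (v $ i * v $ j) * H_mat n z $$ (i, j))"
      by simp
    also have "of_real (v $ i * v $ j) * H_mat n z $$ (i, j) =
        (\<Sum>k<n. (1 - (c k)\<^sup>2) * ((of_real (v $ i) * c k ^ i) * (of_real (v $ j) * c k ^ j)))"
      unfolding H sum_distrib_left by (intro sum.cong refl) (simp add: mult_ac)
    finally show "v $ i * (Re (H_mat n z $$ (i, j)) * v $ j) = Re (\<Sum>k<n. (1 - (c k)\<^sup>2) * ((of_real (v $ i) * c k ^ i) * (of_real (v $ j) * c k ^ j)))" .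
  qed
  also have "\<dots> = Re (\<Sum>i<n. \<Sum>j<n. \<Sum>k<n. (1 - (c k)\<^sup>2) * ((of_real (v $ i) * c k ^ i) * (of_real (v $ j) * c k ^ j)))"
    by (simp only: Re_sum)
  also have "(\<Sum>i<n. \<Sum>j<n. \<Sum>k<n. (1 - (c k)\<^sup>2) * ((of_real (v $ i) * c k ^ i) * (of_real (v $ j) * c k ^ j))) =
      (\<Sum>i<n. \<Sum>k<n. \<Sum>j<n. (1 - (c k)\<^sup>2) * ((of_real (v $ i) * c k ^ i) * (of_real (v $ j) * c k ^ j)))"
    by (intro sum.cong refl sum.swap)
  also have "\<dots> = (\<Sum>k<n. \<Sum>i<n. \<Sum>j<n. (1 - (c k)\<^sup>2) * ((of_real (v $ i) * c k ^ i) * (of_real (v $ j) * c k ^ j)))"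
    by (rule sum.swap)
  also have "\<dots> = (\<Sum>k<n. (1 - (c k)\<^sup>2) * (?q k)\<^sup>2)"
  proof (intro sum.cong refl)
    fix k
    have "(?q k)\<^sup>2 = (\<Sum>i<n. \<Sum>j<n. (of_real (v $ i) * c k ^ i) * (of_real (v $ j) * c k ^ j))"
      unfolding power2_eq_square by (rule sum_product)
    then show "(\<Sum>i<n. \<Sum>j<n. (1 - (c k)\<^sup>2) * ((of_real (v $ i) * c k ^ i) * (of_real (v $ j) * c k ^ j))) =
        (1 - (c k)\<^sup>2) * (?q k)\<^sup>2"
      by (simp only: sum_distrib_left)
  qed
  finally show ?thesis .
qed

lemma psd_H_mat_iff:
  assumes cp: "char_poly (C_mat n z) = (\<Prod>k<n. [:- c k, 1:])"
  shows "psd_mat (map_mat Re (H_mat n z)) \<longleftrightarrow> (\<forall>v\<in>carrier_vec n.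
    0 \<le> Re (\<Sum>k<n. (1 - (c k)\<^sup>2) * (\<Sum>i<n. of_real (v $ i) * c k ^ i)\<^sup>2))"
proof -
  have "transpose_mat (map_mat Re (H_mat n z)) = map_mat Re (H_mat n z)"
    by (rule eq_matI) (auto simp: H_mat_def add.commute)
  moreover have "square_mat (map_mat Re (H_mat n z))" by (simp add: H_mat_def)
  moreover have "dim_row (map_mat Re (H_mat n z)) = n" by (simp add: H_mat_def)
  ultimately show ?thesis
    unfolding psd_mat_def using quadratic_form_H_mat[OF cp] by simp
qed

lemma ex_interpolation:
  fixes val :: "'a :: field \<Rightarrow> 'a"
  assumes "finite S"
  shows "\<exists>a. \<forall>s\<in>S. (\<Sum>i<card S. a i * s ^ i) = val s"
proof -
  have "\<exists>p. (\<forall>i\<ge>card S. coeff p i = 0) \<and> (\<forall>s\<in>S. poly p s = val s)"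
    using assms
  proof (induction S)
    case empty
    show ?case by (rule exI[of _ 0]) simp
  next
    case (insert x S)
    then obtain p where p: "\<And>i. i \<ge> card S \<Longrightarrow> coeff p i = 0" "\<And>s. s \<in> S \<Longrightarrow> poly p s = val s"
      by blast
    define q where "q = (\<Prod>s\<in>S. [:- s, 1:])"
    define r where "r = p + smult ((val x - poly p x) / poly q x) q"
    have q0: "poly q s = 0" if "s \<in> S" for s
      using that insert by (auto simp: q_def poly_prod)
    have qx: "poly q x \<noteq> 0"
      using insert by (auto simp: q_def poly_prod)
    have "degree q \<le> (\<Sum>s\<in>S. degree [:- s, 1:])"
      unfolding q_def by (rule degree_prod_sum_le[OF \<open>finite S\<close>, unfolded o_def])
    then have "coeff q i = 0" if "i \<ge> card (insert x S)" for i
      using that insert by (intro coeff_eq_0) simp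
    then have "\<forall>i\<ge>card (insert x S). coeff r i = 0"
      using p(1) insert by (simp add: r_def)
    moreover have "\<forall>s\<in>insert x S. poly r s = val s"
      using p(2) q0 qx by (simp add: r_def)
    ultimately show ?case by blast
  qed
  then obtain p where p: "\<forall>i\<ge>card S. coeff p i = 0" "\<forall>s\<in>S. poly p s = val s" by blast
  have "poly p s = (\<Sum>i<card S. coeff p i * s ^ i)" for s
  proof (cases "p = 0")
    case False
    then have "degree p < card S" using p(1) by (metis leading_coeff_0_iff not_le)
    then show ?thesis unfolding poly_altdef
      by (intro sum.mono_neutral_left) (auto simp: coeff_eq_0)
  qed simp
  then show ?thesis using p(2) by (intro exI[of _ "coeff p"]) metis
qed

lemma ex_real_interpolation:
  fixes val :: "complex \<Rightarrow> complex"
  assumes S: "finite S" "\<And>s. s \<in> S \<Longrightarrow> cnj s \<in> S" "card S \<le> n"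
    and val: "\<And>s. s \<in> S \<Longrightarrow> val (cnj s) = cnj (val s)"
  shows "\<exists>v. \<forall>s\<in>S. (\<Sum>i<n. of_real (v i :: real) * s ^ i) = val s"
proof -
  obtain a where a: "\<And>s. s \<in> S \<Longrightarrow> (\<Sum>i<card S. a i * s ^ i) = val s"
    using ex_interpolation[OF S(1)] by blast
  define v where "v i = (if i < card S then Re (a i) else 0)" for i
  have "(\<Sum>i<n. of_real (v i) * s ^ i) = val s" if s: "s \<in> S" for s
  proof -
    have "(\<Sum>i<n. of_real (v i) * s ^ i) = (\<Sum>i<card S. of_real (v i) * s ^ i)"
      using S(3) by (intro sum.mono_neutral_right) (auto simp: v_def)
    also have "\<dots> = (\<Sum>i<card S. (a i * s ^ i + cnj (a i * cnj s ^ i)) / 2)"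
    proof (intro sum.cong refl)
      fix i assume i: "i \<in> {..<card S}"
      then have eq: "of_real (v i) = (a i + cnj (a i)) / 2" by (simp add: v_def complex_add_cnj)
      show "of_real (v i) * s ^ i = (a i * s ^ i + cnj (a i * cnj s ^ i)) / 2"
        unfolding eq by (simp add: distrib_right)
    qed
    also have "\<dots> = ((\<Sum>i<card S. a i * s ^ i) + cnj (\<Sum>i<card S. a i * cnj s ^ i)) / 2"
      unfolding cnj_sum sum.distrib[symmetric] sum_divide_distrib ..
    also have "\<dots> = val s"
      unfolding a[OF s] a[OF S(2)[OF s]] val[OF s] by simp
    finally show ?thesis .
  qed
  then show ?thesis by blast
qed

lemma norm_1_of_joukowski:
  assumes y0: "y \<noteq> 0" and c: "(y + 1 / y) / 2 = of_real r" and r: "r\<^sup>2 \<le> 1"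
  shows "cmod y = 1"
proof -
  have "y * y + 1 = of_real (2 * r) * y" using y0 c by (simp add: field_simps)
  then have e: "(y - of_real r)\<^sup>2 = of_real (r\<^sup>2 - 1)"
    by (simp add: power2_eq_square algebra_simps)
  have re: "(Re y - r)\<^sup>2 - (Im y)\<^sup>2 = r\<^sup>2 - 1" and im: "(Re y - r) * Im y = 0"
    using arg_cong[OF e, of Re] arg_cong[OF e, of Im] by (auto simp: power2_eq_square)
  have "Re y = r"
  proof (cases "Im y = 0")
    case True
    then have "(Re y - r)\<^sup>2 \<le> 0" using re r by simp
    then show ?thesis by simp
  qed (use im in simp)
  then have "(Re y)\<^sup>2 + (Im y)\<^sup>2 = 1" using re by simp
  then show ?thesis by (simp add: cmod_def)
qed

text \<open>If some eigenvalue \<open>c k\<close> were outside \<open>[-1, 1]\<close>, a real polynomial taking a value \<open>w\<close> with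
  \<open>(1 - (c k)\<^sup>2) * w\<^sup>2 = -1\<close> there and vanishing at all eigenvalues other than \<open>c k\<close> and its
  conjugate would make the Hermite form negative.\<close>

lemma hermite_form_nonneg_iff:
  fixes c :: "nat \<Rightarrow> complex"
  assumes conj: "\<And>k. k < n \<Longrightarrow> cnj (c k) \<in> c ` {..<n}"
  shows "(\<forall>v\<in>carrier_vec n. 0 \<le> Re (\<Sum>k<n. (1 - (c k)\<^sup>2) * (\<Sum>i<n. of_real (v $ i) * c k ^ i)\<^sup>2)) \<longleftrightarrow>
    (\<forall>k<n. \<exists>r::real. c k = of_real r \<and> r\<^sup>2 \<le> 1)" (is "?L \<longleftrightarrow> ?R")
proof
  assume ?R
  then obtain r :: "nat \<Rightarrow> real" where r: "\<And>k. k < n \<Longrightarrow> c k = of_real (r k)" "\<And>k. k < n \<Longrightarrow> (r k)\<^sup>2 \<le> 1"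
    by metis
  have "0 \<le> Re ((1 - (c k)\<^sup>2) * (\<Sum>i<n. of_real (v $ i) * c k ^ i)\<^sup>2)" if "k < n" for k and v :: "real vec"
  proof -
    have "(1 - (c k)\<^sup>2) * (\<Sum>i<n. of_real (v $ i) * c k ^ i)\<^sup>2 =
        of_real ((1 - (r k)\<^sup>2) * (\<Sum>i<n. v $ i * r k ^ i)\<^sup>2)"
      using r(1)[OF that] by simp
    then have "Re ((1 - (c k)\<^sup>2) * (\<Sum>i<n. of_real (v $ i) * c k ^ i)\<^sup>2) =
        (1 - (r k)\<^sup>2) * (\<Sum>i<n. v $ i * r k ^ i)\<^sup>2" by (simp only: Re_complex_of_real)
    then show ?thesis using r(2)[OF that] by simp
  qed
  then show ?L by (auto simp only: Re_sum lessThan_iff intro!: sum_nonneg)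
next
  assume L: ?L
  show ?R
  proof (intro allI impI, rule ccontr)
    fix k assume k: "k < n" and bad: "\<not> (\<exists>r::real. c k = of_real r \<and> r\<^sup>2 \<le> 1)"
    have "\<exists>w. (1 - (c k)\<^sup>2) * w\<^sup>2 = -1 \<and> (cnj (c k) = c k \<longrightarrow> cnj w = w)"
    proof (cases "cnj (c k) = c k")
      case True
      then obtain r where r: "c k = of_real r" by (metis Reals_cnj_iff Reals_cases)
      then have r1: "r\<^sup>2 > 1" using bad by (metis not_le)
      have "(1 - r\<^sup>2) * (1 / sqrt (r\<^sup>2 - 1))\<^sup>2 = -1"
        using r1 by (simp add: power_divide field_simps)
      then obtain u where u: "(1 - r\<^sup>2) * u\<^sup>2 = -1" by blast
      have "(1 - (c k)\<^sup>2) * (of_real u)\<^sup>2 = of_real ((1 - r\<^sup>2) * u\<^sup>2)"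
        unfolding r by simp
      then show ?thesis unfolding u by (intro exI[of _ "of_real u"]) simp
    next
      case False
      have "1 - (c k)\<^sup>2 \<noteq> 0"
      proof
        assume "1 - (c k)\<^sup>2 = 0"
        then have "c k = 1 \<or> c k = -1" by (simp add: power2_eq_1_iff)
        then show False using False by auto
      qed
      then have "(1 - (c k)\<^sup>2) * (csqrt (- 1 / (1 - (c k)\<^sup>2)))\<^sup>2 = -1" by simp
      then show ?thesis using False by blast
    qed
    then obtain w where w: "(1 - (c k)\<^sup>2) * w\<^sup>2 = -1" "cnj (c k) = c k \<longrightarrow> cnj w = w" by blast
    define val where "val s = (if s = c k then w else if s = cnj (c k) then cnj w else 0)" for s
    have val: "val (cnj s) = cnj (val s)" for s
    proof -
      have "cnj s = c k \<longleftrightarrow> s = cnj (c k)" by (metis complex_cnj_cnj)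
      then show ?thesis using w(2) by (auto simp: val_def)
    qed
    have "\<exists>v. \<forall>s\<in>c ` {..<n}. (\<Sum>i<n. of_real (v i :: real) * s ^ i) = val s"
    proof (rule ex_real_interpolation)
      show "cnj s \<in> c ` {..<n}" if "s \<in> c ` {..<n}" for s using that conj by blast
      show "card (c ` {..<n}) \<le> n" using card_image_le[of "{..<n}" c] by simp
    qed (use val in simp_all)
    then obtain v where v: "\<And>l. l < n \<Longrightarrow> (\<Sum>i<n. of_real (v i :: real) * c l ^ i) = val (c l)"
      by blast
    have val_sq: "(1 - (c l)\<^sup>2) * (val (c l))\<^sup>2 = (if c l = c k \<or> c l = cnj (c k) then - 1 else 0)" for l
    proof -
      have "(1 - (cnj (c k))\<^sup>2) * (cnj w)\<^sup>2 = -1"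
        using arg_cong[OF w(1), of cnj] by simp
      then show ?thesis using w(1) by (auto simp: val_def)
    qed
    have "(\<Sum>l<n. (1 - (c l)\<^sup>2) * (\<Sum>i<n. of_real (vec n v $ i) * c l ^ i)\<^sup>2) =
        (\<Sum>l<n. if c l = c k \<or> c l = cnj (c k) then - 1 else 0)"
      using v val_sq by (intro sum.cong) auto
    then have "Re (\<Sum>l<n. (1 - (c l)\<^sup>2) * (\<Sum>i<n. of_real (vec n v $ i) * c l ^ i)\<^sup>2) =
        (\<Sum>l<n. if c l = c k \<or> c l = cnj (c k) then - 1 else 0)"
      by (simp only: Re_sum) (auto intro!: sum.cong)
    also have "\<dots> < (\<Sum>l<n. 0)"
      using k by (intro sum_strict_mono_ex1) auto
    finally show False using bspec[OF L vec_carrier[of n v]] by (simp only: sum.neutral_const)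
  qed
qed

lemma cnj_eigenvalue:
  assumes n: "n \<ge> 3" and z: "z \<in> conj_space n" and cp: "char_poly (C_mat n z) = (\<Prod>k<n. [:- c k, 1:])"
    and k: "k < n"
  shows "cnj (c k) \<in> c ` {..<n}"
proof -
  have R: "map_mat Re (C_mat n z) \<in> carrier_mat n n" by (simp add: C_mat_def)
  have "char_poly (C_mat n z) = map_poly of_real (char_poly (map_mat Re (C_mat n z)))"
    unfolding of_real_hom.char_poly_hom[OF R, symmetric] C_mat_eq_of_real[OF n z, symmetric] ..
  then have "coeff (char_poly (C_mat n z)) i \<in> \<real>" for i
    by (simp add: coeff_map_poly)
  then have "cnj (poly (char_poly (C_mat n z)) (c k)) = poly (char_poly (C_mat n z)) (cnj (c k))"
    by (rule poly_cnj_real)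
  moreover have root: "poly (char_poly (C_mat n z)) x = 0 \<longleftrightarrow> x \<in> c ` {..<n}" for x
    unfolding cp by (auto simp: poly_prod)
  moreover have "poly (char_poly (C_mat n z)) (c k) = 0" using k root by blast
  ultimately show ?thesis by (metis complex_cnj_zero)
qed

theorem theorem4p3:
  fixes n :: nat
  assumes "n \<ge> 3"
  shows "(\<forall>z \<in> conj_space n. \<forall>i<n. \<forall>j<n. H_mat n z $$ (i, j) \<in> \<real>) \<and>
         orbit_space n = {z \<in> conj_space n. psd_mat (map_mat Re (H_mat n z))}"
proof
  show "\<forall>z \<in> conj_space n. \<forall>i<n. \<forall>j<n. H_mat n z $$ (i, j) \<in> \<real>"
    using H_mat_real[OF assms] by blast
  let ?c = "\<lambda>y k. (y k + 1 / y k) / 2 :: complex"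
  have psd: "psd_mat (map_mat Re (H_mat n z)) \<longleftrightarrow> (\<forall>k<n. \<exists>r::real. ?c y k = of_real r \<and> r\<^sup>2 \<le> 1)"
    if z: "z \<in> conj_space n" and y: "\<And>k. k < n \<Longrightarrow> y k \<noteq> 0" "(\<Prod>k<n. y k) = 1"
      "\<And>i. i \<le> n \<Longrightarrow> of_nat (n choose i) * zcoord n z i = esym n i y" for z y
  proof -
    note cp = char_poly_C_mat[OF assms y]
    show ?thesis
      using psd_H_mat_iff[OF cp] hermite_form_nonneg_iff[OF cnj_eigenvalue[OF assms z cp]]
      by (rule trans)
  qed
  have n: "n \<ge> 2" "n \<ge> 1" using assms by auto
  show "orbit_space n = {z \<in> conj_space n. psd_mat (map_mat Re (H_mat n z))}"
    unfolding orbit_space_eq_esym[OF n(1)]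
  proof (intro subset_antisym subsetI)
    fix z assume "z \<in> {z \<in> carrier_vec (n - 1). \<exists>y. (\<forall>k<n. cmod (y k) = 1) \<and> (\<Prod>k<n. y k) = 1 \<and>
      (\<forall>i\<in>{1..n - 1}. of_nat (n choose i) * zcoord n z i = esym n i y)}"
    then obtain y where zc: "z \<in> carrier_vec (n - 1)"
      and y: "\<forall>k<n. cmod (y k) = 1" "(\<Prod>k<n. y k) = 1"
      and e': "\<forall>i\<in>{1..n - 1}. of_nat (n choose i) * zcoord n z i = esym n i y" by blast
    have e: "of_nat (n choose i) * zcoord n z i = esym n i y" if "i \<le> n" for i
    proof (cases "i = 0 \<or> i = n")
      case True
      then show ?thesis using y(2) by (auto simp: zcoord_def esym_0 esym_top)
    next
      case False
      then have "i \<in> {1..n - 1}" using that by auto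
      then show ?thesis using e' by blast
    qed
    have y0: "y k \<noteq> 0" if "k < n" for k using y(1) that by (metis norm_zero zero_neq_one)
    have "cnj (zcoord n z i) = zcoord n z (n - i)" if "i \<in> {1..n - 1}" for i
    proof -
      have i: "i \<le> n" "n - i \<le> n" using that by auto
      have "of_nat (n choose i) * cnj (zcoord n z i) = cnj (esym n i y)"
        using arg_cong[OF e[OF i(1)], of cnj] by simp
      also have "\<dots> = esym n (n - i) y" using y i by (intro cnj_esym) auto
      also have "\<dots> = of_nat (n choose (n - i)) * zcoord n z (n - i)" using e[OF i(2)] by simp
      also have "n choose (n - i) = n choose i" using i(1) by (rule binomial_symmetric[symmetric])
      finally show ?thesis using i(1) by (auto simp only: mult_cancel_left of_nat_eq_0_iff binomial_eq_0_iff)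
    qed
    then have z: "z \<in> conj_space n" using zc by (simp add: conj_space_def)
    have "\<exists>r::real. ?c y k = of_real r \<and> r\<^sup>2 \<le> 1" if "k < n" for k
    proof -
      have norm: "cmod (y k) = 1" using y(1) that by blast
      then have "1 / y k = cnj (y k)"
        using y0[OF that] complex_norm_square[of "y k"] by (simp add: field_simps)
      then have "?c y k = of_real (Re (y k))" by (simp add: complex_add_cnj)
      moreover have "(Re (y k))\<^sup>2 \<le> 1"
        using abs_Re_le_cmod[of "y k"] norm by (simp add: abs_square_le_1)
      ultimately show ?thesis by blast
    qed
    then show "z \<in> {z \<in> conj_space n. psd_mat (map_mat Re (H_mat n z))}"
      using z psd[OF z y0 y(2) e] by simp
  next
    fix z assume "z \<in> {z \<in> conj_space n. psd_mat (map_mat Re (H_mat n z))}"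
    then have z: "z \<in> conj_space n" and p: "psd_mat (map_mat Re (H_mat n z))" by auto
    obtain y where y: "\<And>k. k < n \<Longrightarrow> y k \<noteq> 0" "(\<Prod>k<n. y k) = 1"
      "\<And>i. i \<le> n \<Longrightarrow> of_nat (n choose i) * zcoord n z i = esym n i y"
      using ex_root_coordinates[OF n(2)] by blast
    have "cmod (y k) = 1" if "k < n" for k
    proof -
      obtain r :: real where r: "?c y k = of_real r" "r\<^sup>2 \<le> 1"
        using psd[OF z y] p \<open>k < n\<close> by blast
      from y(1)[OF that] r show ?thesis by (rule norm_1_of_joukowski)
    qed
    moreover have "z \<in> carrier_vec (n - 1)" using z by (simp add: conj_space_def)
    moreover have "of_nat (n choose i) * zcoord n z i = esym n i y" if "i \<in> {1..n - 1}" for i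
      using that by (intro y(3)) auto
    ultimately show "z \<in> {z \<in> carrier_vec (n - 1). \<exists>y. (\<forall>k<n. cmod (y k) = 1) \<and> (\<Prod>k<n. y k) = 1 \<and>
      (\<forall>i\<in>{1..n - 1}. of_nat (n choose i) * zcoord n z i = esym n i y)}"
      using y(2) by blast
  qed
qed

end
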